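(* Fix $n,m\in\mathbb{Z}_{\ge0}$ and $\alpha>0$. For every Schur-concave objective $f:\mathbb{Z}_{\ge0}^n\to\mathbb{R}_{\ge0}$ and every (possibly randomized) allocation strategy $\mathcal{A}'$, $$\mathrm{Reg}^{n,m}_{f,\alpha}(\mathrm{BL})\le \mathrm{Reg}^{n,m}_{f,\alpha}(\mathcal{A}').$$ Likewise, for every Schur-convex objective $g:\mathbb{Z}_{\ge0}^n\to\mathbb{R}_{\ge0}$ and every allocation strategy $\mathcal{A}'$, $$\mathrm{Reg}^{n,m}_{g,\alpha}(\mathrm{BL})\le \mathrm{Reg}^{n,m}_{g,\alpha}(\mathcal{A}').$$ Here $f$ is an objective to be maximized and $g$ is an objective to be minimized, with the corresponding definitions of regret.
   Context: **Notation.** $[n]=\{1,\dots,n\}$; for a vector $\mathbf{x}$ indexed by $[n]$ and $A\subseteq[n]$, $\mathbf{x}(A)=\sum_{i\in A}\mathbf{x}(i)$. **Discrete polymatroids.** A rank function is $r:2^{[n]}\to\mathbb{Z}_{\ge 0}$ that is normalized ($r(\emptyset)=0$), monotone ($r(A)\le r(B)$ for $A\subseteq B$) and submodular ($r(A)+r(B)\ge r(A\cap B)+r(A\cup B)$). It defines the discrete polymatroid $P=\{\mathbf{x}\in\mathbb{Z}_{\ge0}^n : \mathbf{x}(A)\le r(A)\ \forall A\subseteq[n]\}$, with $\mathrm{Rank}(P)=r([n])$ and $\mathrm{Bases}(P)=\{\mathbf{x}\in P:\mathbf{x}([n])=r([n])\}$. **Game.** On round $t=1,2,\dots$ the adversary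 presents a discrete polymatroid $P_t$ on $[n]$; the algorithm designer then irrevocably selects a basis $\mathbf{x}_t\in\mathrm{Bases}(P_t)$. The game ends after a finite number $h$ of rounds, when $\sum_{t=1}^h \mathrm{Rank}(P_t)=m$ exactly. An adversarial strategy $\mathcal{P}$ deterministically maps the history of play (all previous polymatroids and selected bases) to the next polymatroid; $\mathcal{P}_{n,m}$ is the set of adversarial strategies for $n$ agents and $m$ resources (against every designer strategy, the total rank presented is exactly $m$). An allocation strategy $\mathcal{A}$ maps, possibly at random, a history of play and the currently presented polymatroid to a basis of that polymatroid. The profile $(\mathcal{A},\mathcal{P})$ induces a (possibly random) sequence of polymatroids $(P_t)_{t\in[h]}$ and bases $(\mathbf{x}_t)_{t\in[h]}$; set $\boldsymbol{\ell}(\mathcal{A},\mathcal{P})=\sum_{t\in[h]}\mathbf{x}_t$ (the load vector) and $H(\mathcal{A},\mathcal{P})=\{\sum_{t\in[h]}\mathbf{z}_t:\mathbf{z}_t\in\mathrm{Bases}(P_t)\}$. **Majorization.** For $\mathbf{x},\mathbf{y}\in\mathbb{Z}_{\ge0}^n$ with $\mathbf{x}([n])=\mathbf{y}([n])$, write $\mathbf{x}\succeq\mathbf{y}$ (equivalently $\mathbf{y}\preceq\mathbf{x}$) when $\mathbf{x}^{\uparrow}([k])\le\mathbf{y}^{\uparrow}([k])$ for all $k\in[n]$, where $\mathbf{x}^\uparrow(i)$ is the $i$-th smallest entry of $\mathbf{x}$. A function $f$ is Schur-concave if $\mathbf{x}\preceq\mathbf{y}$ implies $f(\mathbf{x})\ge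 f(\mathbf{y})$; $g$ is Schur-convex if $\mathbf{x}\preceq\mathbf{y}$ implies $g(\mathbf{x})\le g(\mathbf{y})$. **Cost and regret.** For $f$ to be maximized, $c_{f,\alpha}(\mathcal{A},\mathcal{P})=\mathbb{E}_{\mathcal{A}}\big[\alpha\cdot\sup_{\boldsymbol{\ell}^*\in H(\mathcal{A},\mathcal{P})}f(\boldsymbol{\ell}^* )-f(\boldsymbol{\ell}(\mathcal{A},\mathcal{P}))\big]$. For $g$ to be minimized, $c_{g,\alpha}(\mathcal{A},\mathcal{P})=\mathbb{E}_{\mathcal{A}}\big[g(\boldsymbol{\ell}(\mathcal{A},\mathcal{P}))-\alpha\cdot\inf_{\boldsymbol{\ell}^*\in H(\mathcal{A},\mathcal{P})}g(\boldsymbol{\ell}^* )\big]$. In both cases the $\alpha$-regret is the supremum of the cost over adversaries: $\mathrm{Reg}^{n,m}_{f,\alpha}(\mathcal{A})=\sup_{\mathcal{P}\in\mathcal{P}_{n,m}}c_{f,\alpha}(\mathcal{A},\mathcal{P})$ and $\mathrm{Reg}^{n,m}_{g,\alpha}(\mathcal{A})=\sup_{\mathcal{P}\in\mathcal{P}_{n,m}}c_{g,\alpha}(\mathcal{A},\mathcal{P})$. **Brick-Laying.** $\mathrm{BL}$ is the deterministic strategy which, on round $t$ with current load $\boldsymbol{\ell}_{t-1}=\sum_{s<t}\mathbf{x}_s$, selects any $\mathbf{x}_t\in\mathrm{Bases}(P_t)$ with $\boldsymbol{\ell}_{t-1}+\mathbf{x}_t\preceq\boldsymbol{\ell}_{t-1}+\mathbf{x}$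 for all $\mathbf{x}\in\mathrm{Bases}(P_t)$ (such a basis always exists; ties are broken by an arbitrary deterministic rule). *)

theory Defs
  imports "HOL-Probability.Probability"
begin

text \<open>
  Agents are the elements of \<open>{1..n}\<close>. A vector in \<open>\<int>\<^sub>\<ge>\<^sub>0\<^sup>n\<close> is a function
  \<open>nat \<Rightarrow> nat\<close> that vanishes outside \<open>{1..n}\<close>, so that equality and addition of vectors
  are equality and pointwise addition of functions; \<open>n = 0\<close> is allowed.
\<close>

type_synonym nvec = "nat \<Rightarrow> nat"

definition vecs :: "nat \<Rightarrow> nvec set" where
  "vecs n = {x. \<forall>i. i \<notin> {1..n} \<longrightarrow> x i = 0}"

definition vplus :: "nvec \<Rightarrow> nvec \<Rightarrow> nvec" where
  "vplus x y = (\<lambda>i. x i + y i)"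


subsection \<open>Majorization\<close>

definition ith_smallest :: "nat \<Rightarrow> nvec \<Rightarrow> nat \<Rightarrow> nat" where
  "ith_smallest n x i = sort (map x [1..<Suc n]) ! (i - 1)"

text \<open>\<open>majorized n y x\<close> is \<open>y \<preceq> x\<close>: the smaller vector is the more balanced one.\<close>

definition majorized :: "nat \<Rightarrow> nvec \<Rightarrow> nvec \<Rightarrow> bool" where
  "majorized n y x \<longleftrightarrow>
     sum x {1..n} = sum y {1..n} \<and>
     (\<forall>k\<in>{1..n}. (\<Sum>i=1..k. ith_smallest n x i) \<le> (\<Sum>i=1..k. ith_smallest n y i))"

definition schur_concave :: "nat \<Rightarrow> (nvec \<Rightarrow> real) \<Rightarrow> bool" where
  "schur_concave n f \<longleftrightarrow> (\<forall>x\<in>vecs n. \<forall>y\<in>vecs n. majorized n x y \<longrightarrow> f x \<ge> f y)"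

definition schur_convex :: "nat \<Rightarrow> (nvec \<Rightarrow> real) \<Rightarrow> bool" where
  "schur_convex n g \<longleftrightarrow> (\<forall>x\<in>vecs n. \<forall>y\<in>vecs n. majorized n x y \<longrightarrow> g x \<le> g y)"


subsection \<open>Discrete polymatroids\<close>

text \<open>Only the values of a rank function on subsets of \<open>{1..n}\<close> matter.\<close>

definition rank_function :: "nat \<Rightarrow> (nat set \<Rightarrow> nat) \<Rightarrow> bool" where
  "rank_function n r \<longleftrightarrow>
     r {} = 0 \<and>
     (\<forall>A B. A \<subseteq> B \<and> B \<subseteq> {1..n} \<longrightarrow> r A \<le> r B) \<and>
     (\<forall>A B. A \<subseteq> {1..n} \<and> B \<subseteq> {1..n} \<longrightarrow> r (A \<inter> B) + r (A \<union> B) \<le> r A + r B)"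

definition polymatroid_of :: "nat \<Rightarrow> (nat set \<Rightarrow> nat) \<Rightarrow> nvec set" where
  "polymatroid_of n r = {x \<in> vecs n. \<forall>A\<subseteq>{1..n}. sum x A \<le> r A}"

definition discrete_polymatroid :: "nat \<Rightarrow> nvec set \<Rightarrow> bool" where
  "discrete_polymatroid n P \<longleftrightarrow> (\<exists>r. rank_function n r \<and> P = polymatroid_of n r)"

text \<open>
  The description below is unique because the rank function is determined on subsets of
  \<open>{1..n}\<close> by the polymatroid.
\<close>

definition poly_rank :: "nat \<Rightarrow> nvec set \<Rightarrow> nat" where
  "poly_rank n P = (THE k. \<exists>r. rank_function n r \<and> P = polymatroid_of n r \<and> k = r {1..n})"

definition bases :: "nat \<Rightarrow> nvec set \<Rightarrow> nvec set" where
  "bases n P = {x \<in> P. sum x {1..n} = poly_rank n P}"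


subsection \<open>The game\<close>

text \<open>A history lists the presented polymatroids and selected bases in chronological order.\<close>

type_synonym history = "(nvec set \<times> nvec) list"
type_synonym adversary = "history \<Rightarrow> nvec set"
type_synonym allocation = "history \<Rightarrow> nvec set \<Rightarrow> nvec pmf"

definition total_rank :: "nat \<Rightarrow> history \<Rightarrow> nat" where
  "total_rank n hs = (\<Sum>t<length hs. poly_rank n (fst (hs ! t)))"

definition load :: "history \<Rightarrow> nvec" where
  "load hs = (\<lambda>i. \<Sum>t<length hs. snd (hs ! t) i)"

definition hindsight :: "nat \<Rightarrow> history \<Rightarrow> nvec set" where
  "hindsight n hs = {\<lambda>i. \<Sum>t<length hs. z t i | z. \<forall>t<length hs. z t \<in> bases n (fst (hs ! t))}"

definition allocation_strategies :: "nat \<Rightarrow> allocation set" where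
  "allocation_strategies n =
     {A. \<forall>hs P. discrete_polymatroid n P \<longrightarrow> set_pmf (A hs P) \<subseteq> bases n P}"

text \<open>
  Distribution of the history after \<open>t\<close> rounds, where a history of total rank \<open>m\<close> is final
  and is kept unchanged.
\<close>

primrec play :: "nat \<Rightarrow> nat \<Rightarrow> allocation \<Rightarrow> adversary \<Rightarrow> nat \<Rightarrow> history pmf" where
  "play n m A adv 0 = return_pmf []"
| "play n m A adv (Suc t) =
     bind_pmf (play n m A adv t)
       (\<lambda>hs. if total_rank n hs = m then return_pmf hs
             else map_pmf (\<lambda>x. hs @ [(adv hs, x)]) (A hs (adv hs)))"

definition game_over :: "nat \<Rightarrow> nat \<Rightarrow> allocation \<Rightarrow> adversary \<Rightarrow> nat \<Rightarrow> bool" where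
  "game_over n m A adv t \<longleftrightarrow> (\<forall>hs\<in>set_pmf (play n m A adv t). total_rank n hs = m)"

text \<open>
  An adversary that overshoots \<open>m\<close>, or that presents polymatroids of rank \<open>0\<close> forever,
  is excluded by the second condition. Every polymatroid has finitely many bases, so
  finiteness of every play is the same as a bound on the number of rounds.
\<close>

definition adversarial_strategies :: "nat \<Rightarrow> nat \<Rightarrow> adversary set" where
  "adversarial_strategies n m =
     {adv. (\<forall>hs. discrete_polymatroid n (adv hs)) \<and>
           (\<forall>A\<in>allocation_strategies n. \<exists>t. game_over n m A adv t)}"

definition outcome :: "nat \<Rightarrow> nat \<Rightarrow> allocation \<Rightarrow> adversary \<Rightarrow> history pmf" where
  "outcome n m A adv = play n m A adv (LEAST t. game_over n m A adv t)"


subsection \<open>Cost and regret\<close>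

definition cost_max ::
    "nat \<Rightarrow> nat \<Rightarrow> (nvec \<Rightarrow> real) \<Rightarrow> real \<Rightarrow> allocation \<Rightarrow> adversary \<Rightarrow> real" where
  "cost_max n m f \<alpha> A adv =
     measure_pmf.expectation (outcome n m A adv)
       (\<lambda>hs. \<alpha> * (SUP l\<in>hindsight n hs. f l) - f (load hs))"

definition cost_min ::
    "nat \<Rightarrow> nat \<Rightarrow> (nvec \<Rightarrow> real) \<Rightarrow> real \<Rightarrow> allocation \<Rightarrow> adversary \<Rightarrow> real" where
  "cost_min n m g \<alpha> A adv =
     measure_pmf.expectation (outcome n m A adv)
       (\<lambda>hs. g (load hs) - \<alpha> * (INF l\<in>hindsight n hs. g l))"

definition regret_max ::
    "nat \<Rightarrow> nat \<Rightarrow> (nvec \<Rightarrow> real) \<Rightarrow> real \<Rightarrow> allocation \<Rightarrow> ereal" where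
  "regret_max n m f \<alpha> A = (SUP adv\<in>adversarial_strategies n m. ereal (cost_max n m f \<alpha> A adv))"

definition regret_min ::
    "nat \<Rightarrow> nat \<Rightarrow> (nvec \<Rightarrow> real) \<Rightarrow> real \<Rightarrow> allocation \<Rightarrow> ereal" where
  "regret_min n m g \<alpha> A = (SUP adv\<in>adversarial_strategies n m. ereal (cost_min n m g \<alpha> A adv))"


subsection \<open>Brick-Laying\<close>

definition brick_laying_choices :: "nat \<Rightarrow> history \<Rightarrow> nvec set \<Rightarrow> nvec set" where
  "brick_laying_choices n hs P =
     {x \<in> bases n P. \<forall>z\<in>bases n P. majorized n (vplus (load hs) x) (vplus (load hs) z)}"

type_synonym tie_rule = "history \<Rightarrow> nvec set \<Rightarrow> nvec set \<Rightarrow> nvec"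

definition tie_breaking :: "tie_rule \<Rightarrow> bool" where
  "tie_breaking tie \<longleftrightarrow> (\<forall>hs P S. S \<noteq> {} \<longrightarrow> tie hs P S \<in> S)"

definition brick_laying :: "nat \<Rightarrow> tie_rule \<Rightarrow> allocation" where
  "brick_laying n tie hs P = return_pmf (tie hs P (brick_laying_choices n hs P))"

end

theory Submission
  imports Defs
begin

text \<open>
  Majorization is compared through the truncated sums \<open>\<Sum>i. min (x i) c\<close>. If no unit exchange
  improves a basis \<open>x\<close> on top of a load \<open>l\<close>, then submodularity yields, for each level \<open>c\<close>, a tight
  set containing all agents below \<open>c\<close> on which \<open>x\<close> places no brick above \<open>c\<close>. Hence the brick-laying
  choice exists, and a set of agents whose final loads stay below \<open>c\<close> receives in hindsight no more
  bricks than brick-laying places up to height \<open>c\<close>.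

  Given brick-laying loads \<open>b\<close> and a hindsight load \<open>l\<close> with sorted entries \<open>y 0 \<le> \<dots> \<le> y (n - 1)\<close>, the
  following adversary is played against any other strategy: phase \<open>k\<close> presents \<open>y k\<close> times the
  rank-one uniform matroid on the active agents and then removes the agent with the smallest load.
  Assigning each phase to the agent removed at its end realizes \<open>l\<close> up to permutation in
  hindsight, while the bound above forces the \<open>k\<close> removed agents to carry at most the \<open>k\<close> smallest
  entries of \<open>b\<close>. The new play is therefore at least as costly on every realization of the strategy.
\<close>

section \<open>Majorization\<close>

definition sorted_vec :: "nat \<Rightarrow> nvec \<Rightarrow> nat list" where
  "sorted_vec n x = sort (map x [1..<Suc n])"

lemma length_sorted_vec [simp]: "length (sorted_vec n x) = n"
  by (simp add: sorted_vec_def)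

lemma sorted_vec_mono: "i \<le> j \<Longrightarrow> j < n \<Longrightarrow> sorted_vec n x ! i \<le> sorted_vec n x ! j"
  using sorted_nth_mono[of "sorted_vec n x" i j] by (simp add: sorted_vec_def)

lemma sum_ith_smallest:
  "(\<Sum>i=1..k. ith_smallest n x i) = (\<Sum>j<k. sorted_vec n x ! j)"
  unfolding ith_smallest_def sorted_vec_def
  by (rule sum.reindex_bij_witness[of _ Suc "\<lambda>i. i - 1"]) auto

lemma sum_sorted_vec:
  "(\<Sum>i=1..n. h (x i)) = (\<Sum>j<n. h (sorted_vec n x ! j) :: nat)"
proof -
  have "(\<Sum>j<n. h (sorted_vec n x ! j)) = sum_list (map h (sorted_vec n x))"
    by (simp add: sum_list_sum_nth lessThan_atLeast0)
  also have "\<dots> = sum_mset (image_mset h (mset (sorted_vec n x)))"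
    by (metis mset_map sum_mset_sum_list)
  also have "\<dots> = sum_mset (image_mset h (mset (map x [1..<Suc n])))"
    by (simp only: sorted_vec_def mset_sort)
  also have "\<dots> = sum_list (map (\<lambda>i. h (x i)) [1..<Suc n])"
    by (metis (no_types, lifting) mset_map sum_mset_sum_list map_map comp_apply map_eq_conv)
  also have "\<dots> = (\<Sum>i=1..n. h (x i))"
    by (simp only: interv_sum_list_conv_sum_set_nat set_upt atLeastLessThanSuc_atLeastAtMost)
  finally show ?thesis by simp
qed

section \<open>Truncated sums against sums of smallest entries\<close>

lemma sum_lessThan_split:
  fixes f :: "nat \<Rightarrow> nat"
  assumes "k \<le> n"
  shows "(\<Sum>j<n. f j) = (\<Sum>j<k. f j) + (\<Sum>j=k..<n. f j)"
  using assms by (simp add: lessThan_atLeast0 sum.atLeastLessThan_concat)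

text \<open>Each of the \<open>k\<close> smallest entries is bounded by itself and every other one
  by \<open>c\<close>. By \<open>sum_min_eq\<close> the bound is attained once \<open>c\<close>
  separates the two groups, which links truncated sums to sums of smallest entries.\<close>

lemma sum_min_le:
  assumes "k \<le> n"
  shows "(\<Sum>i=1..n. min (x i) c) \<le> (\<Sum>j<k. sorted_vec n x ! j) + (n - k) * c"
proof -
  have "(\<Sum>i=1..n. min (x i) c) = (\<Sum>j<n. min (sorted_vec n x ! j) c)"
    by (rule sum_sorted_vec)
  also have "\<dots> = (\<Sum>j<k. min (sorted_vec n x ! j) c) + (\<Sum>j=k..<n. min (sorted_vec n x ! j) c)"
    by (rule sum_lessThan_split[OF assms])
  also have "\<dots> \<le> (\<Sum>j<k. sorted_vec n x ! j) + (\<Sum>j=k..<n. c)"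
    by (intro add_mono sum_mono) auto
  finally show ?thesis by simp
qed

lemma sum_min_eq:
  assumes "k \<le> n" "\<And>j. j < k \<Longrightarrow> sorted_vec n x ! j \<le> c"
    "\<And>j. k \<le> j \<Longrightarrow> j < n \<Longrightarrow> c \<le> sorted_vec n x ! j"
  shows "(\<Sum>i=1..n. min (x i) c) = (\<Sum>j<k. sorted_vec n x ! j) + (n - k) * c"
proof -
  have "(\<Sum>i=1..n. min (x i) c) = (\<Sum>j<n. min (sorted_vec n x ! j) c)"
    by (rule sum_sorted_vec)
  also have "\<dots> = (\<Sum>j<k. min (sorted_vec n x ! j) c) + (\<Sum>j=k..<n. min (sorted_vec n x ! j) c)"
    by (rule sum_lessThan_split[OF assms(1)])
  also have "\<dots> = (\<Sum>j<k. sorted_vec n x ! j) + (\<Sum>j=k..<n. c)"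
    using assms(2,3) by (intro arg_cong2[where f = "(+)"] sum.cong) auto
  finally show ?thesis by simp
qed

lemma sum_min_sorted_vec_nth:
  assumes "k < n"
  shows "(\<Sum>i=1..n. min (x i) (sorted_vec n x ! k)) =
    (\<Sum>j<Suc k. sorted_vec n x ! j) + (n - Suc k) * (sorted_vec n x ! k)"
  using assms by (intro sum_min_eq) (auto intro: sorted_vec_mono)

text \<open>Truncate at the largest of the \<open>card K\<close> smallest entries: the truncated sum
  is then known exactly, and the agents outside \<open>K\<close> contribute at most \<open>c\<close>
  each, which cancels.\<close>

lemma sum_smallest_le_sum:
  assumes "K \<subseteq> {1..n}"
  shows "(\<Sum>j<card K. sorted_vec n x ! j) \<le> sum x K"
proof (cases "card K")
  case (Suc k)
  have fin: "finite K" using assms finite_subset by blast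
  have le: "card K \<le> n" using card_mono[OF _ assms] by simp
  define c where "c = sorted_vec n x ! k"
  have "(\<Sum>j<card K. sorted_vec n x ! j) + (n - card K) * c = (\<Sum>i=1..n. min (x i) c)"
    using sum_min_sorted_vec_nth[of k n x] Suc le by (simp add: c_def)
  also have "\<dots> = (\<Sum>i\<in>K. min (x i) c) + (\<Sum>i\<in>{1..n} - K. min (x i) c)"
    using assms by (simp add: sum.subset_diff add.commute)
  also have "\<dots> \<le> sum x K + (\<Sum>i\<in>{1..n} - K. c)"
    by (intro add_mono sum_mono) auto
  also have "\<dots> = sum x K + (n - card K) * c"
    using assms fin by (simp add: card_Diff_subset)
  finally show ?thesis by simp
qed simp

lemma majorized_iff_sum_smallest:
  "majorized n y x \<longleftrightarrow> sum x {1..n} = sum y {1..n} \<and>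
     (\<forall>k\<le>n. (\<Sum>j<k. sorted_vec n x ! j) \<le> (\<Sum>j<k. sorted_vec n y ! j))"
proof -
  have "(\<forall>k\<in>{1..n}. Q k) \<longleftrightarrow> (\<forall>k\<le>n. Q k)" if "Q 0" for Q :: "nat \<Rightarrow> bool"
    using that by (metis One_nat_def Suc_leI atLeastAtMost_iff neq0_conv)
  from this[of "\<lambda>k. (\<Sum>j<k. sorted_vec n x ! j) \<le> (\<Sum>j<k. sorted_vec n y ! j)"]
  show ?thesis by (simp add: majorized_def sum_ith_smallest del: One_nat_def)
qed

text \<open>Both directions evaluate the truncated sum of one vector exactly and bound the other by
  \<open>sum_min_le\<close>: a given \<open>c\<close> fixes an index \<open>k\<close> fitting
  \<open>y\<close>, a given \<open>k\<close> fixes a level \<open>c\<close> fitting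
  \<open>x\<close>. The truncated form involves no sorting and can be split over sets of
  agents.\<close>

lemma majorized_iff_sum_min:
  "majorized n y x \<longleftrightarrow> sum x {1..n} = sum y {1..n} \<and>
     (\<forall>c. (\<Sum>i=1..n. min (x i) c) \<le> (\<Sum>i=1..n. min (y i) c))"
proof (intro iffI conjI allI; (elim conjE)?)
  fix c assume *: "majorized n y x"
  \<comment> \<open>By sortedness the first \<open>k\<close> entries of \<open>y\<close> are exactly
    those below \<open>c\<close>.\<close>
  define k where "k = card {j. j < n \<and> sorted_vec n y ! j < c}"
  have k: "j < k \<longleftrightarrow> sorted_vec n y ! j < c" if "j < n" for j
  proof
    assume "j < k"
    show "sorted_vec n y ! j < c"
    proof (rule ccontr)
      assume "\<not> sorted_vec n y ! j < c"
      then have "{j. j < n \<and> sorted_vec n y ! j < c} \<subseteq> {..<j}"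
        using sorted_vec_mono[of j _ n y] by (auto simp: not_less intro: leI) (meson leD leI order.trans)
      from card_mono[OF _ this] show False using \<open>j < k\<close> by (simp add: k_def)
    qed
  next
    assume "sorted_vec n y ! j < c"
    then have "{..j} \<subseteq> {j. j < n \<and> sorted_vec n y ! j < c}"
      using sorted_vec_mono[of _ j n y] that by force
    from card_mono[OF _ this] show "j < k" by (simp add: k_def)
  qed
  have "k \<le> n"
    unfolding k_def by (rule order.trans[OF card_mono[of "{..<n}"]]) auto
  have "(\<Sum>i=1..n. min (x i) c) \<le> (\<Sum>j<k. sorted_vec n x ! j) + (n - k) * c"
    by (rule sum_min_le) fact
  also have "\<dots> \<le> (\<Sum>j<k. sorted_vec n y ! j) + (n - k) * c"
    using * \<open>k \<le> n\<close> by (simp add: majorized_iff_sum_smallest)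
  also have "\<dots> = (\<Sum>i=1..n. min (y i) c)"
  proof (rule sum_min_eq[symmetric])
    show "sorted_vec n y ! j \<le> c" if "j < k" for j
      using k[of j] that \<open>k \<le> n\<close> by simp
    show "c \<le> sorted_vec n y ! j" if "k \<le> j" "j < n" for j
      using k[of j] that by (simp add: not_less)
  qed fact
  finally show "(\<Sum>i=1..n. min (x i) c) \<le> (\<Sum>i=1..n. min (y i) c)" .
next
  assume s: "sum x {1..n} = sum y {1..n}"
    and *: "\<forall>c. (\<Sum>i=1..n. min (x i) c) \<le> (\<Sum>i=1..n. min (y i) c)"
  show "majorized n y x"
    unfolding majorized_iff_sum_smallest
  proof (intro conjI allI impI s)
    fix k assume "k \<le> n"
    show "(\<Sum>j<k. sorted_vec n x ! j) \<le> (\<Sum>j<k. sorted_vec n y ! j)"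
    proof (cases k)
      case (Suc k')
      define c where "c = sorted_vec n x ! k'"
      have "(\<Sum>j<k. sorted_vec n x ! j) + (n - k) * c = (\<Sum>i=1..n. min (x i) c)"
        using sum_min_sorted_vec_nth[of k' n x] Suc \<open>k \<le> n\<close> by (simp add: c_def)
      also have "\<dots> \<le> (\<Sum>i=1..n. min (y i) c)" using * by blast
      also have "\<dots> \<le> (\<Sum>j<k. sorted_vec n y ! j) + (n - k) * c"
        by (rule sum_min_le) fact
      finally show ?thesis by simp
    qed simp
  qed
qed (simp add: majorized_def)

lemma majorized_of_sorted_vec_eq:
  assumes "sorted_vec n x = sorted_vec n y"
  shows "majorized n x y"
  using assms sum_sorted_vec[of "\<lambda>a. a" x n] sum_sorted_vec[of "\<lambda>a. a" y n]
  by (simp add: majorized_iff_sum_smallest)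


section \<open>Discrete polymatroids\<close>

text \<open>Natural subtraction and the order of the updates make this a transfer of one unit from
  \<open>i\<close> to \<open>j\<close> only if \<open>i \<noteq> j\<close> and
  \<open>x i \<ge> 1\<close>.\<close>

definition unit_exchange :: "nvec \<Rightarrow> nat \<Rightarrow> nat \<Rightarrow> nvec" where
  "unit_exchange x i j = x(i := x i - 1, j := x j + 1)"

definition tight :: "nat \<Rightarrow> (nat set \<Rightarrow> nat) \<Rightarrow> nvec \<Rightarrow> nat set \<Rightarrow> bool" where
  "tight n r x A \<longleftrightarrow> A \<subseteq> {1..n} \<and> sum x A = r A"

lemma sum_increment:
  fixes x :: nvec
  assumes "finite A" "j \<in> A"
  shows "sum (x(j := x j + 1)) A = sum x A + 1"
  using assms by (simp add: sum.remove[of A j])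

section \<open>Tight sets of a member of a polymatroid\<close>

context
  fixes n :: nat and r :: "nat set \<Rightarrow> nat" and x :: nvec
  assumes r: "rank_function n r" and x: "x \<in> polymatroid_of n r"
begin

lemma sum_le_rank: "A \<subseteq> {1..n} \<Longrightarrow> sum x A \<le> r A"
  using x by (auto simp: polymatroid_of_def)

text \<open>Uncrossing: the sums over \<open>A \<inter> B\<close> and \<open>A \<union> B\<close>
  add up to \<open>r A + r B\<close>, submodularity bounds the two ranks by the same total, and
  neither sum exceeds its rank, so both are equal to it.\<close>

lemma tight_Int_Un:
  assumes "tight n r x A" "tight n r x B"
  shows "tight n r x (A \<inter> B)" "tight n r x (A \<union> B)"
proof -
  have AB: "A \<subseteq> {1..n}" "B \<subseteq> {1..n}" using assms by (auto simp: tight_def)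
  then have fin: "finite A" "finite B" using finite_subset by auto
  have "sum x (A \<union> B) + sum x (A \<inter> B) = r A + r B"
    using sum.union_inter[OF fin, of x] assms by (simp add: tight_def)
  moreover have "r (A \<inter> B) + r (A \<union> B) \<le> r A + r B"
    using r AB by (auto simp: rank_function_def)
  moreover have "sum x (A \<inter> B) \<le> r (A \<inter> B)" "sum x (A \<union> B) \<le> r (A \<union> B)"
    using AB by (auto intro!: sum_le_rank)
  ultimately show "tight n r x (A \<inter> B)" "tight n r x (A \<union> B)"
    using AB by (auto simp: tight_def)
qed

lemma tight_empty: "tight n r x {}"
  using r by (simp add: tight_def rank_function_def)

lemma tight_UN:
  "finite I \<Longrightarrow> (\<And>i. i \<in> I \<Longrightarrow> tight n r x (F i)) \<Longrightarrow> tight n r x (\<Union>i\<in>I. F i)"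
  by (induction I rule: finite_induct) (simp_all add: tight_empty tight_Int_Un)

text \<open>The extra set \<open>T\<close> keeps the intersection tight, and inside the ground set,
  when \<open>I\<close> is empty.\<close>

lemma tight_INT:
  "finite I \<Longrightarrow> tight n r x T \<Longrightarrow> (\<And>i. i \<in> I \<Longrightarrow> tight n r x (F i)) \<Longrightarrow>
    tight n r x (T \<inter> (\<Inter>i\<in>I. F i))"
proof (induction I rule: finite_induct)
  case (insert i I)
  have "tight n r x (F i \<inter> (T \<inter> (\<Inter>i\<in>I. F i)))"
    by (intro tight_Int_Un(1)[OF _ insert.IH] insert.prems) simp_all
  then show ?case by (simp add: Int_left_commute)
qed simp

text \<open>A set whose constraint breaks must have gained, so it contains \<open>j\<close>; the
  gain is a single unit, so the constraint was tight before.\<close>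

lemma tight_of_not_increment:
  assumes "j \<in> {1..n}" "x(j := x j + 1) \<notin> polymatroid_of n r"
  shows "\<exists>A. tight n r x A \<and> j \<in> A"
proof -
  have "x(j := x j + 1) \<in> vecs n"
    using x assms(1) by (auto simp: polymatroid_of_def vecs_def)
  then obtain A where A: "A \<subseteq> {1..n}" "sum (x(j := x j + 1)) A > r A"
    using assms(2) by (auto simp: polymatroid_of_def not_le)
  have fin: "finite A" using A finite_subset by auto
  have "j \<in> A"
  proof (rule ccontr)
    assume "j \<notin> A"
    then have "sum (x(j := x j + 1)) A = sum x A" by (intro sum.cong) auto
    then show False using A sum_le_rank[of A] by simp
  qed
  moreover have "sum (x(j := x j + 1)) A = sum x A + 1"
    using fin \<open>j \<in> A\<close> by (rule sum_increment)
  ultimately show ?thesis using A sum_le_rank[of A] by (auto simp: tight_def)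
qed

text \<open>As for a single increment, except that a set which also contains \<open>i\<close> gains
  nothing and cannot become violated.\<close>

lemma tight_of_not_exchange:
  assumes "i \<in> {1..n}" "j \<in> {1..n}" "i \<noteq> j" "x i \<ge> 1" "unit_exchange x i j \<notin> polymatroid_of n r"
  shows "\<exists>A. tight n r x A \<and> j \<in> A \<and> i \<notin> A"
proof -
  let ?x' = "unit_exchange x i j"
  have "?x' \<in> vecs n"
    using x assms(1,2) by (auto simp: polymatroid_of_def vecs_def unit_exchange_def)
  then obtain A where A: "A \<subseteq> {1..n}" "sum ?x' A > r A"
    using assms(5) by (auto simp: polymatroid_of_def not_le)
  have fin: "finite A" using A finite_subset by auto
  \<comment> \<open>The loss at \<open>i\<close> is added on the left instead of subtracted on the
    right, which avoids natural subtraction.\<close>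
  have s: "sum ?x' A + (if i \<in> A then 1 else 0) = sum x A + (if j \<in> A then 1 else 0)"
  proof -
    have "(\<Sum>a\<in>A. ?x' a + (if a = i then 1 else 0)) = (\<Sum>a\<in>A. x a + (if a = j then 1 else 0))"
      using assms(3,4) by (intro sum.cong) (auto simp: unit_exchange_def)
    then show ?thesis using fin by (simp add: sum.distrib)
  qed
  then have "j \<in> A" "i \<notin> A" using A sum_le_rank[of A] by (auto split: if_splits)
  then show ?thesis using s A sum_le_rank[of A] by (auto simp: tight_def)
qed

end

lemma sum_unit_exchange:
  assumes "i \<in> {1..n}" "j \<in> {1..n}" "i \<noteq> j" "x i \<ge> 1"
  shows "sum (unit_exchange x i j) {1..n} = sum x {1..n}"
proof -
  have "(\<Sum>a=1..n. unit_exchange x i j a + (if a = i then 1 else 0)) =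
      (\<Sum>a=1..n. x a + (if a = j then 1 else 0))"
    using assms(3,4) by (intro sum.cong) (auto simp: unit_exchange_def)
  then show ?thesis using assms(1,2) by (simp add: sum.distrib)
qed

section \<open>Bases: existence, rank and finiteness\<close>

lemma finite_vecs_sum_le: "finite {x \<in> vecs n. sum x {1..n} \<le> m}"
proof (rule finite_subset)
  show "{x \<in> vecs n. sum x {1..n} \<le> m} \<subseteq> {x. (\<forall>i. (i \<in> {1..n} \<longrightarrow> x i \<in> {..m}) \<and> (i \<notin> {1..n} \<longrightarrow> x i = 0))}"
  proof clarify
    fix x i assume x: "x \<in> vecs n" "sum x {1..n} \<le> m"
    have "x i \<le> sum x {1..n}" if "i \<in> {1..n}" using that by (intro member_le_sum) auto
    then show "(i \<in> {1..n} \<longrightarrow> x i \<in> {..m}) \<and> (i \<notin> {1..n} \<longrightarrow> x i = 0)"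
      using x by (auto simp: vecs_def)
  qed
qed (rule finite_set_of_finite_funs; simp)

text \<open>In a member of maximal sum no agent can be incremented, so every agent lies in a tight
  set; the union of these sets is tight and equals the ground set.\<close>

lemma exists_basis:
  assumes r: "rank_function n r"
  shows "\<exists>x\<in>polymatroid_of n r. sum x {1..n} = r {1..n}"
proof -
  let ?S = "(\<lambda>x. sum x {1..n}) ` polymatroid_of n r"
  have "?S \<subseteq> {..r {1..n}}" by (auto simp: polymatroid_of_def)
  then have fin: "finite ?S" using finite_subset by blast
  have "(\<lambda>_. 0) \<in> polymatroid_of n r" by (auto simp: polymatroid_of_def vecs_def)
  then have "Max ?S \<in> ?S" using fin by (intro Max_in) auto
  then obtain x where x: "x \<in> polymatroid_of n r" "sum x {1..n} = Max ?S" by auto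
  have "\<exists>A. tight n r x A \<and> j \<in> A" if j: "j \<in> {1..n}" for j
  proof (rule tight_of_not_increment[OF r x(1) j], rule)
    assume "x(j := x j + 1) \<in> polymatroid_of n r"
    then have "sum (x(j := x j + 1)) {1..n} \<le> Max ?S" using fin by (intro Max_ge imageI)
    moreover have "sum (x(j := x j + 1)) {1..n} = sum x {1..n} + 1"
      using j by (intro sum_increment) auto
    ultimately show False using x by simp
  qed
  then obtain F where F: "\<And>j. j \<in> {1..n} \<Longrightarrow> tight n r x (F j) \<and> j \<in> F j" by metis
  then have "tight n r x (\<Union>j\<in>{1..n}. F j)" by (intro tight_UN[OF r x(1)]) auto
  moreover have "(\<Union>j\<in>{1..n}. F j) = {1..n}" using F unfolding tight_def by blast
  ultimately show ?thesis using x by (auto simp: tight_def)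
qed

text \<open>Two rank functions of the same polymatroid agree on the ground set, since a basis for
  one obeys the bound of the other. Hence the description in \<open>poly_rank\<close> is
  unique.\<close>

lemma poly_rank_polymatroid_of:
  assumes r: "rank_function n r"
  shows "poly_rank n (polymatroid_of n r) = r {1..n}"
proof -
  have le: "r' {1..n} \<le> r'' {1..n}"
    if r': "rank_function n r'" and eq: "polymatroid_of n r' = polymatroid_of n r''" for r' r''
  proof -
    obtain x where "x \<in> polymatroid_of n r'" "sum x {1..n} = r' {1..n}"
      using exists_basis[OF r'] by auto
    then show ?thesis unfolding eq by (auto simp: polymatroid_of_def)
  qed
  show ?thesis unfolding poly_rank_def
  proof (rule the_equality)
    show "\<exists>r'. rank_function n r' \<and> polymatroid_of n r = polymatroid_of n r' \<and> r {1..n} = r' {1..n}"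
      using r by blast
  next
    fix k assume "\<exists>r'. rank_function n r' \<and> polymatroid_of n r = polymatroid_of n r' \<and> k = r' {1..n}"
    then obtain r' where r': "rank_function n r'" "polymatroid_of n r = polymatroid_of n r'"
      "k = r' {1..n}" by blast
    show "k = r {1..n}"
      using le[OF r r'(2)] le[OF r'(1) r'(2)[symmetric]] r'(3) by simp
  qed
qed

lemma bases_polymatroid_of:
  "rank_function n r \<Longrightarrow>
    bases n (polymatroid_of n r) = {x \<in> polymatroid_of n r. sum x {1..n} = r {1..n}}"
  by (simp add: bases_def poly_rank_polymatroid_of)

lemma bases_nonempty: "discrete_polymatroid n P \<Longrightarrow> bases n P \<noteq> {}"
  unfolding discrete_polymatroid_def using exists_basis[of n] bases_polymatroid_of[of n] by blast

lemma bases_vecs: "discrete_polymatroid n P \<Longrightarrow> x \<in> bases n P \<Longrightarrow> x \<in> vecs n"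
  by (auto simp: discrete_polymatroid_def bases_def polymatroid_of_def)

lemma finite_bases: "discrete_polymatroid n P \<Longrightarrow> finite (bases n P)"
  by (rule finite_subset[OF _ finite_vecs_sum_le[of n "poly_rank n P"]])
    (auto simp: bases_vecs, simp add: bases_def)

text \<open>Local optimality under unit exchanges. The gap \<open>2\<close> is the smallest at which
  moving a brick improves the balance; a gap of \<open>1\<close> would only swap the two
  heights.\<close>

definition locally_balanced :: "nat \<Rightarrow> nvec set \<Rightarrow> nvec \<Rightarrow> nvec \<Rightarrow> bool" where
  "locally_balanced n P l x \<longleftrightarrow> x \<in> bases n P \<and>
     (\<forall>i\<in>{1..n}. \<forall>j\<in>{1..n}. x i \<ge> 1 \<and> l i + x i \<ge> l j + x j + 2 \<longrightarrow>
        unit_exchange x i j \<notin> bases n P)"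

text \<open>Every pair of an agent \<open>j\<close> below \<open>c\<close> and an agent
  \<open>i\<close> with a brick of \<open>x\<close> above \<open>c\<close> admits no exchange, hence
  is separated by a tight set. Combining these gives one tight set \<open>T\<close>, and by
  tightness no basis places more on \<open>T\<close> than \<open>x\<close> does.\<close>

lemma locally_balanced_separating_set:
  assumes P: "discrete_polymatroid n P" and lb: "locally_balanced n P l x"
  obtains T where "T \<subseteq> {1..n}" "\<And>j. j \<in> {1..n} \<Longrightarrow> l j + x j < c \<Longrightarrow> j \<in> T"
    "\<And>i. i \<in> T \<Longrightarrow> l i + x i \<le> c \<or> x i = 0" "\<And>z. z \<in> bases n P \<Longrightarrow> sum z T \<le> sum x T"
proof -
  obtain r where r: "rank_function n r" and Pr: "P = polymatroid_of n r"
    using P by (auto simp: discrete_polymatroid_def)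
  have xB: "x \<in> bases n P" using lb by (simp add: locally_balanced_def)
  then have x: "x \<in> polymatroid_of n r" and sx: "sum x {1..n} = r {1..n}"
    using r Pr bases_polymatroid_of by auto
  define W where "W = {i\<in>{1..n}. x i \<ge> 1 \<and> l i + x i > c}"
  define K where "K = {j\<in>{1..n}. l j + x j < c}"
  have "\<exists>A. tight n r x A \<and> j \<in> A \<and> i \<notin> A" if "j \<in> K" "i \<in> W" for i j
  proof (rule tight_of_not_exchange[OF r x])
    show *: "i \<in> {1..n}" "j \<in> {1..n}" "i \<noteq> j" "x i \<ge> 1" using that by (auto simp: K_def W_def)
    \<comment> \<open>Heights strictly on opposite sides of \<open>c\<close> differ by at least
      \<open>2\<close>.\<close>
    have "unit_exchange x i j \<notin> bases n P"
      using lb that unfolding locally_balanced_def K_def W_def by auto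
    then show "unit_exchange x i j \<notin> polymatroid_of n r"
      using sum_unit_exchange[where x = x, OF *] sx r by (auto simp: Pr bases_polymatroid_of)
  qed
  then have "\<forall>i j. \<exists>A. j \<in> K \<longrightarrow> i \<in> W \<longrightarrow> tight n r x A \<and> j \<in> A \<and> i \<notin> A" by blast
  then obtain F where F: "\<And>i j. j \<in> K \<Longrightarrow> i \<in> W \<Longrightarrow> tight n r x (F i j) \<and> j \<in> F i j \<and> i \<notin> F i j"
    unfolding choice_iff by blast
  \<comment> \<open>The intersection over \<open>W\<close> discards all agents with a brick above
    \<open>c\<close>, and the union over \<open>K\<close> still covers \<open>K\<close>; the factor
    \<open>{1..n}\<close> matters when \<open>W\<close> is empty.\<close>
  define T where "T = (\<Union>j\<in>K. {1..n} \<inter> (\<Inter>i\<in>W. F i j))"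
  have "tight n r x T" unfolding T_def
    using F sx by (intro tight_UN[OF r x] tight_INT[OF r x]) (auto simp: K_def W_def tight_def)
  then have T: "T \<subseteq> {1..n}" "sum x T = r T" by (auto simp: tight_def)
  show ?thesis
  proof
    show "T \<subseteq> {1..n}" by fact
    show "j \<in> T" if "j \<in> {1..n}" "l j + x j < c" for j
      using that F unfolding T_def K_def by auto
    show "l i + x i \<le> c \<or> x i = 0" if "i \<in> T" for i
    proof (rule ccontr)
      assume "\<not> (l i + x i \<le> c \<or> x i = 0)"
      then have "i \<in> W" using that T by (auto simp: W_def)
      then show False using that F unfolding T_def by auto
    qed
    show "sum z T \<le> sum x T" if "z \<in> bases n P" for z
      using that T by (auto simp: Pr bases_def polymatroid_of_def)
  qed
qed


section \<open>Brick-laying\<close>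

text \<open>Local optimality implies global optimality. At level \<open>c\<close>, split at the
  separating set \<open>T\<close>: inside, every brick of \<open>x\<close> counts and
  \<open>z\<close> has no more bricks there; outside, \<open>x\<close> already reaches
  \<open>c\<close>.\<close>

lemma majorized_of_locally_balanced:
  assumes P: "discrete_polymatroid n P" and lb: "locally_balanced n P l x" and z: "z \<in> bases n P"
  shows "majorized n (vplus l x) (vplus l z)"
  unfolding majorized_iff_sum_min
proof (intro conjI allI)
  have "sum x {1..n} = sum z {1..n}" using lb z by (simp add: locally_balanced_def bases_def)
  then show "sum (vplus l z) {1..n} = sum (vplus l x) {1..n}"
    by (simp add: vplus_def sum.distrib)
  fix c
  obtain T where T: "T \<subseteq> {1..n}" "\<And>j. j \<in> {1..n} \<Longrightarrow> l j + x j < c \<Longrightarrow> j \<in> T"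
    "\<And>i. i \<in> T \<Longrightarrow> l i + x i \<le> c \<or> x i = 0" "sum z T \<le> sum x T"
    using locally_balanced_separating_set[OF P lb, of c] z by metis
  have "(\<Sum>i\<in>T. min (l i + z i) c) \<le> (\<Sum>i\<in>T. min (l i) c + z i)"
    by (intro sum_mono) auto
  also have "\<dots> \<le> (\<Sum>i\<in>T. min (l i) c + x i)" using T(4) by (simp add: sum.distrib)
  also have "\<dots> = (\<Sum>i\<in>T. min (l i + x i) c)"
  proof (rule sum.cong[OF refl])
    fix i assume "i \<in> T"
    from T(3)[OF this] show "min (l i) c + x i = min (l i + x i) c" by (auto simp: min_def)
  qed
  finally have 1: "(\<Sum>i\<in>T. min (l i + z i) c) \<le> (\<Sum>i\<in>T. min (l i + x i) c)" .
  have 2: "(\<Sum>i\<in>{1..n} - T. min (l i + z i) c) \<le> (\<Sum>i\<in>{1..n} - T. min (l i + x i) c)"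
  proof (rule sum_mono)
    fix i assume "i \<in> {1..n} - T"
    then have "c \<le> l i + x i" using T(2)[of i] by (meson DiffD1 DiffD2 leI)
    then show "min (l i + z i) c \<le> min (l i + x i) c" by auto
  qed
  show "(\<Sum>i=1..n. min (vplus l z i) c) \<le> (\<Sum>i=1..n. min (vplus l x i) c)"
    using add_mono[OF 2 1] T(1)
    by (simp only: vplus_def sum.subset_diff[OF T(1) finite_atLeastAtMost])
qed

text \<open>A basis minimizing the sum of squared heights works, because an exchange across a gap of
  at least \<open>2\<close> strictly decreases that sum.\<close>

lemma exists_locally_balanced:
  assumes P: "discrete_polymatroid n P"
  shows "\<exists>x. locally_balanced n P l x"
proof -
  define \<phi> where "\<phi> x = (\<Sum>i=1..n. (l i + x i)\<^sup>2)" for x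
  define x where "x = arg_min_on \<phi> (bases n P)"
  have xB: "x \<in> bases n P"
    unfolding x_def using finite_bases[OF P] bases_nonempty[OF P] by (rule arg_min_if_finite)
  have min: "\<phi> x \<le> \<phi> y" if "y \<in> bases n P" for y
    unfolding x_def using finite_bases[OF P] bases_nonempty[OF P] that by (rule arg_min_least)
  have "unit_exchange x i j \<notin> bases n P"
    if ij: "i \<in> {1..n}" "j \<in> {1..n}" "x i \<ge> 1" "l i + x i \<ge> l j + x j + 2" for i j
  proof
    assume y: "unit_exchange x i j \<in> bases n P"
    have "i \<noteq> j" using ij by auto
    define h where "h = (\<lambda>y a. (l a + y a)\<^sup>2 :: nat)"
    have split: "\<phi> y = h y i + h y j + (\<Sum>a\<in>{1..n} - {i} - {j}. h y a)" for y
    proof -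
      have "\<phi> y = h y i + (\<Sum>a\<in>{1..n} - {i}. h y a)"
        unfolding \<phi>_def h_def using ij by (intro sum.remove) auto
      also have "(\<Sum>a\<in>{1..n} - {i}. h y a) = h y j + (\<Sum>a\<in>{1..n} - {i} - {j}. h y a)"
        using ij \<open>i \<noteq> j\<close> by (intro sum.remove) auto
      finally show ?thesis by simp
    qed
    have rest: "(\<Sum>a\<in>{1..n} - {i} - {j}. h (unit_exchange x i j) a) = (\<Sum>a\<in>{1..n} - {i} - {j}. h x a)"
      by (intro sum.cong) (auto simp: h_def unit_exchange_def)
    \<comment> \<open>The height of \<open>i\<close> after the exchange is \<open>a\<close>, so the
      comparison of squares is free of subtraction.\<close>
    obtain a where a: "l i + x i = Suc a" using ij by (cases "l i + x i") auto
    have "l i + unit_exchange x i j i = a" "l j + unit_exchange x i j j = Suc (l j + x j)"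
      using ij a \<open>i \<noteq> j\<close> by (auto simp: unit_exchange_def)
    then have "h (unit_exchange x i j) i + h (unit_exchange x i j) j = a\<^sup>2 + (Suc (l j + x j))\<^sup>2"
      by (simp only: h_def)
    also have "\<dots> < (Suc a)\<^sup>2 + (l j + x j)\<^sup>2"
      using ij(4) a by (simp add: power2_eq_square)
    also have "\<dots> = h x i + h x j" by (simp add: h_def a)
    finally have "\<phi> (unit_exchange x i j) < \<phi> x" unfolding split rest by simp
    then show False using min[OF y] by simp
  qed
  then show ?thesis using xB by (auto simp: locally_balanced_def)
qed

lemma brick_laying_choices_nonempty:
  "discrete_polymatroid n P \<Longrightarrow> brick_laying_choices n hs P \<noteq> {}"
  using exists_locally_balanced[of n P "load hs"] majorized_of_locally_balanced[of n P "load hs"]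
  unfolding brick_laying_choices_def locally_balanced_def by blast

text \<open>Converse of \<open>majorized_of_locally_balanced\<close>: an available exchange would
  strictly increase one truncated sum, against majorization.\<close>

lemma locally_balanced_brick_laying:
  assumes "x \<in> brick_laying_choices n hs P"
  shows "locally_balanced n P (load hs) x"
  unfolding locally_balanced_def
proof (intro conjI ballI impI notI)
  let ?l = "load hs"
  show "x \<in> bases n P" using assms by (simp add: brick_laying_choices_def)
  fix i j assume ij: "i \<in> {1..n}" "j \<in> {1..n}" "1 \<le> x i \<and> ?l j + x j + 2 \<le> ?l i + x i"
    and y: "unit_exchange x i j \<in> bases n P"
  let ?y = "unit_exchange x i j"
  \<comment> \<open>One above the height of \<open>j\<close>: agent \<open>i\<close> still reaches
    \<open>c\<close> after losing a brick, while the brick gained by \<open>j\<close> counts in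
    full.\<close>
  define c where "c = ?l j + x j + 1"
  have "majorized n (vplus ?l x) (vplus ?l ?y)"
    using assms y by (simp add: brick_laying_choices_def)
  then have "(\<Sum>a=1..n. min (vplus ?l ?y a) c) \<le> (\<Sum>a=1..n. min (vplus ?l x a) c)"
    by (simp add: majorized_iff_sum_min)
  moreover have "(\<Sum>a=1..n. min (vplus ?l x a) c) < (\<Sum>a=1..n. min (vplus ?l ?y a) c)"
    using ij by (intro sum_strict_mono_ex1) (auto simp: vplus_def unit_exchange_def c_def intro!: bexI[of _ j])
  ultimately show False by simp
qed

section \<open>Plays\<close>

lemma load_take: "t \<le> length hs \<Longrightarrow> load (take t hs) i = (\<Sum>s<t. snd (hs ! s) i)"
  by (simp add: load_def)

lemma load_take_Suc:
  "t < length hs \<Longrightarrow> load (take (Suc t) hs) i = load (take t hs) i + snd (hs ! t) i"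
  by (simp add: load_take)

definition valid_history :: "nat \<Rightarrow> history \<Rightarrow> bool" where
  "valid_history n hs \<longleftrightarrow> (\<forall>t<length hs. discrete_polymatroid n (fst (hs ! t)) \<and>
     snd (hs ! t) \<in> bases n (fst (hs ! t)))"

lemma sum_sum_bases:
  assumes "\<forall>t<length hs. z t \<in> bases n (fst (hs ! t))" "s \<le> length hs"
  shows "(\<Sum>i=1..n. \<Sum>t<s. z t i) = total_rank n (take s hs)"
proof -
  have "(\<Sum>i=1..n. \<Sum>t<s. z t i) = (\<Sum>t<s. \<Sum>i=1..n. z t i)" by (rule sum.swap)
  also have "\<dots> = (\<Sum>t<s. poly_rank n (fst (hs ! t)))"
    using assms by (intro sum.cong) (auto simp: bases_def)
  finally show ?thesis using assms by (simp add: total_rank_def)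
qed

lemma sum_load:
  "valid_history n hs \<Longrightarrow> s \<le> length hs \<Longrightarrow> sum (load (take s hs)) {1..n} = total_rank n (take s hs)"
  using sum_sum_bases[of hs "\<lambda>t. snd (hs ! t)" n s] by (simp add: load_take valid_history_def)

lemma load_vecs:
  assumes "valid_history n hs"
  shows "load hs \<in> vecs n"
proof -
  have "snd (hs ! t) \<in> vecs n" if "t < length hs" for t
    using assms that bases_vecs unfolding valid_history_def by blast
  then show ?thesis by (simp add: load_def vecs_def)
qed

lemma hindsight_vecs:
  assumes "valid_history n hs" "l \<in> hindsight n hs"
  shows "l \<in> vecs n" "sum l {1..n} = total_rank n hs"
proof -
  obtain z where z: "l = (\<lambda>i. \<Sum>t<length hs. z t i)" "\<forall>t<length hs. z t \<in> bases n (fst (hs ! t))"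
    using assms(2) by (auto simp: hindsight_def)
  have "z t \<in> vecs n" if "t < length hs" for t
    using assms(1) z(2) that bases_vecs unfolding valid_history_def by blast
  then show "l \<in> vecs n" using z(1) by (simp add: vecs_def)
  show "sum l {1..n} = total_rank n hs"
    using sum_sum_bases[OF z(2) order.refl] z(1) by simp
qed

lemma finite_hindsight: "valid_history n hs \<Longrightarrow> finite (hindsight n hs)"
  by (rule finite_subset[OF _ finite_vecs_sum_le[of n "total_rank n hs"]])
    (auto dest: hindsight_vecs)

lemma hindsight_nonempty: "valid_history n hs \<Longrightarrow> hindsight n hs \<noteq> {}"
  by (auto simp: hindsight_def valid_history_def)

lemma total_rank_snoc: "total_rank n (hs @ [h]) = total_rank n hs + poly_rank n (fst h)"
  by (simp add: total_rank_def nth_append)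

section \<open>Histories in the support of a play\<close>

lemma set_pmf_play_round:
  assumes "hs \<in> set_pmf (play n m A adv t)" "s < length hs"
  shows "fst (hs ! s) = adv (take s hs) \<and> snd (hs ! s) \<in> set_pmf (A (take s hs) (adv (take s hs)))"
  using assms
proof (induction t arbitrary: hs)
  case (Suc t)
  from Suc.prems(1) obtain hs' where hs': "hs' \<in> set_pmf (play n m A adv t)"
    "hs = hs' \<or> (\<exists>x\<in>set_pmf (A hs' (adv hs')). hs = hs' @ [(adv hs', x)])"
    by (auto split: if_splits)
  from hs'(2) show ?case
  proof
    assume "hs = hs'"
    then show ?case using Suc.IH[OF hs'(1)] Suc.prems by simp
  next
    assume "\<exists>x\<in>set_pmf (A hs' (adv hs')). hs = hs' @ [(adv hs', x)]"
    then obtain x where x: "x \<in> set_pmf (A hs' (adv hs'))" "hs = hs' @ [(adv hs', x)]" by blast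
    show ?case
    proof (cases "s < length hs'")
      case True
      then show ?thesis using Suc.IH[OF hs'(1)] x(2) by (simp add: nth_append)
    next
      case False
      then have "s = length hs'" using Suc.prems(2) x(2) by simp
      then show ?thesis using x by simp
    qed
  qed
qed simp

lemma set_pmf_play_valid:
  assumes "A \<in> allocation_strategies n" "\<And>hs. discrete_polymatroid n (adv hs)"
    "hs \<in> set_pmf (play n m A adv t)"
  shows "valid_history n hs"
  unfolding valid_history_def
proof (intro allI impI)
  fix s assume "s < length hs"
  from set_pmf_play_round[OF assms(3) this] show "discrete_polymatroid n (fst (hs ! s)) \<and>
     snd (hs ! s) \<in> bases n (fst (hs ! s))"
    using assms(1,2) by (fastforce simp: allocation_strategies_def)
qed

lemma finite_set_pmf_play:
  assumes "A \<in> allocation_strategies n" "\<And>hs. discrete_polymatroid n (adv hs)"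
  shows "finite (set_pmf (play n m A adv t))"
proof (induction t)
  case (Suc t)
  have "finite (set_pmf (A hs (adv hs)))" for hs
    using assms(1) by (intro finite_subset[OF _ finite_bases[OF assms(2)[of hs]]])
      (simp add: allocation_strategies_def assms(2))
  then show ?case using Suc by simp
qed simp

lemma outcome_total_rank:
  assumes "A \<in> allocation_strategies n" "adv \<in> adversarial_strategies n m"
    "hs \<in> set_pmf (outcome n m A adv)"
  shows "total_rank n hs = m"
proof -
  have "\<exists>t. game_over n m A adv t"
    using assms(1,2) unfolding adversarial_strategies_def by blast
  then have "game_over n m A adv (LEAST t. game_over n m A adv t)" by (rule LeastI_ex)
  then show ?thesis using assms(3) unfolding game_over_def outcome_def by blast
qed

lemma outcome_valid:
  assumes "A \<in> allocation_strategies n" "adv \<in> adversarial_strategies n m"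
    "hs \<in> set_pmf (outcome n m A adv)"
  shows "valid_history n hs"
  by (rule set_pmf_play_valid[OF assms(1) _ assms(3)[unfolded outcome_def]])
    (use assms(2) in \<open>simp add: adversarial_strategies_def\<close>)

text \<open>Reduces a comparison of costs to single histories: the cost of brick-laying is a
  constant \<open>c\<close>, and the finite support of a play supplies integrability.\<close>

lemma expectation_outcome_ge:
  fixes h :: "history \<Rightarrow> real"
  assumes "A \<in> allocation_strategies n" "adv \<in> adversarial_strategies n m"
    "\<And>hs. hs \<in> set_pmf (outcome n m A adv) \<Longrightarrow> c \<le> h hs"
  shows "c \<le> measure_pmf.expectation (outcome n m A adv) h"
proof (rule measure_pmf.integral_ge_const)
  show "integrable (measure_pmf (outcome n m A adv)) h"
    unfolding outcome_def using assms(1,2)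
    by (intro integrable_measure_pmf_finite finite_set_pmf_play)
      (auto simp: adversarial_strategies_def)
  show "AE hs in measure_pmf (outcome n m A adv). c \<le> h hs"
    using assms(3) by (simp add: AE_measure_pmf_iff)
qed

section \<open>Histories of brick-laying\<close>

lemma brick_laying_mem_strategies:
  assumes "tie_breaking tie"
  shows "brick_laying n tie \<in> allocation_strategies n"
proof -
  have "tie hs P (brick_laying_choices n hs P) \<in> bases n P" if "discrete_polymatroid n P" for hs P
  proof -
    have "tie hs P (brick_laying_choices n hs P) \<in> brick_laying_choices n hs P"
      using assms brick_laying_choices_nonempty[OF that] by (simp add: tie_breaking_def)
    then show ?thesis by (simp add: brick_laying_choices_def)
  qed
  then show ?thesis by (auto simp: allocation_strategies_def brick_laying_def)
qed

lemma play_brick_laying_deterministic: "\<exists>hs. play n m (brick_laying n tie) adv t = return_pmf hs"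
proof (induction t)
  case (Suc t)
  then obtain hs where "play n m (brick_laying n tie) adv t = return_pmf hs" by blast
  then have "play n m (brick_laying n tie) adv (Suc t) = return_pmf (if total_rank n hs = m then hs
      else hs @ [(adv hs, tie hs (adv hs) (brick_laying_choices n hs (adv hs)))])"
    by (simp add: bind_return_pmf brick_laying_def[of n tie hs])
  then show ?case by blast
qed simp

text \<open>Records only that each basis is a brick-laying choice, so the analysis is independent of
  the adversary and of the tie rule.\<close>

definition brick_laying_history :: "nat \<Rightarrow> history \<Rightarrow> bool" where
  "brick_laying_history n hs \<longleftrightarrow> (\<forall>t<length hs. discrete_polymatroid n (fst (hs ! t)) \<and>
     snd (hs ! t) \<in> brick_laying_choices n (take t hs) (fst (hs ! t)))"

lemma outcome_brick_laying:
  assumes "tie_breaking tie" "adv \<in> adversarial_strategies n m"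
    "hs \<in> set_pmf (outcome n m (brick_laying n tie) adv)"
  shows "brick_laying_history n hs"
  unfolding brick_laying_history_def
proof (intro allI impI)
  fix t assume t: "t < length hs"
  have P: "discrete_polymatroid n (adv (take t hs))"
    using assms(2) by (simp add: adversarial_strategies_def)
  have "tie (take t hs) (adv (take t hs)) (brick_laying_choices n (take t hs) (adv (take t hs)))
      \<in> brick_laying_choices n (take t hs) (adv (take t hs))"
    using assms(1) brick_laying_choices_nonempty[OF P] by (simp add: tie_breaking_def)
  then show "discrete_polymatroid n (fst (hs ! t)) \<and>
     snd (hs ! t) \<in> brick_laying_choices n (take t hs) (fst (hs ! t))"
    using set_pmf_play_round[OF assms(3)[unfolded outcome_def] t] P by (simp add: brick_laying_def)
qed

text \<open>In each round the separating set \<open>T\<close> at level \<open>c\<close> contains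
  \<open>K\<close>, so \<open>z\<close> gives \<open>K\<close> at most the bricks that brick-laying
  puts on \<open>T\<close>. All of these lie at height at most \<open>c\<close>, so the truncated
  load grows at least as fast as the left side.\<close>

lemma brick_laying_hindsight_le:
  assumes hs: "brick_laying_history n hs" and z: "\<forall>t<length hs. z t \<in> bases n (fst (hs ! t))"
    and K: "K \<subseteq> {1..n}" "\<And>j. j \<in> K \<Longrightarrow> load hs j < c" and s: "s \<le> length hs"
  shows "(\<Sum>t<s. sum (z t) K) \<le> (\<Sum>i=1..n. min (load (take s hs) i) c)"
  using s
proof (induction s)
  case (Suc s)
  let ?l = "load (take s hs)" and ?x = "snd (hs ! s)"
  have s: "s < length hs" using Suc.prems by simp
  have "locally_balanced n (fst (hs ! s)) ?l ?x"
    using hs s by (intro locally_balanced_brick_laying) (auto simp: brick_laying_history_def)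
  moreover have "discrete_polymatroid n (fst (hs ! s))"
    using hs s by (simp add: brick_laying_history_def)
  ultimately obtain T where T: "T \<subseteq> {1..n}" "\<And>j. j \<in> {1..n} \<Longrightarrow> ?l j + ?x j < c \<Longrightarrow> j \<in> T"
    "\<And>i. i \<in> T \<Longrightarrow> ?l i + ?x i \<le> c \<or> ?x i = 0"
    "\<And>z. z \<in> bases n (fst (hs ! s)) \<Longrightarrow> sum z T \<le> sum ?x T"
    using locally_balanced_separating_set by metis
  \<comment> \<open>Loads never decrease, so an agent that ends below \<open>c\<close> is below
    \<open>c\<close> after every round.\<close>
  have "K \<subseteq> T"
  proof
    fix j assume j: "j \<in> K"
    have "?l j + ?x j = (\<Sum>t<Suc s. snd (hs ! t) j)" using s by (simp add: load_take)
    also have "\<dots> \<le> load hs j" unfolding load_def using s by (intro sum_mono2) auto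
    finally show "j \<in> T" using K j by (intro T(2)) fastforce+
  qed
  then have "sum (z s) K \<le> sum (z s) T"
    using T(1) by (intro sum_mono2) (auto intro: finite_subset)
  also have "\<dots> \<le> sum ?x T" using z s by (intro T(4)) simp
  finally have "(\<Sum>t<Suc s. sum (z t) K) \<le> (\<Sum>i=1..n. min (?l i) c) + sum ?x T"
    using Suc by simp
  also have "\<dots> = (\<Sum>i\<in>{1..n} - T. min (?l i) c) + (\<Sum>i\<in>T. min (?l i) c + ?x i)"
    by (simp only: sum.subset_diff[OF T(1) finite_atLeastAtMost] sum.distrib add.assoc)
  also have "\<dots> \<le> (\<Sum>i\<in>{1..n} - T. min (?l i + ?x i) c) + (\<Sum>i\<in>T. min (?l i + ?x i) c)"
  proof (intro add_mono sum_mono)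
    show "min (?l i) c + ?x i \<le> min (?l i + ?x i) c" if "i \<in> T" for i
      using T(3)[OF that] by (auto simp: min_def)
  qed (auto simp: min_def)
  also have "\<dots> = (\<Sum>i=1..n. min (load (take (Suc s) hs) i) c)"
    by (simp only: sum.subset_diff[OF T(1) finite_atLeastAtMost] load_take_Suc[OF s])
  finally show ?case .
qed simp

text \<open>
  The \<open>k + 1\<close> agents with the smallest loads have load at most that of the \<open>k + 1\<close>st one, so the
  bricks given to them in hindsight are placed by brick-laying at height at most one above it.
\<close>

lemma brick_laying_hindsight_sorted_le:
  assumes hs: "brick_laying_history n hs" and l: "l \<in> hindsight n hs" and k: "k < n"
  defines "b \<equiv> sorted_vec n (load hs)"
  shows "(\<Sum>j<Suc k. sorted_vec n l ! j) < (\<Sum>j<k. b ! j) + (n - k) * Suc (b ! k)"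
proof -
  \<comment> \<open>Sorting the agents themselves, rather than their loads, lets \<open>K\<close> be
    a set of agents that carries the first \<open>k + 1\<close> entries of \<open>b\<close>.\<close>
  define as where "as = sort_key (load hs) [1..<Suc n]"
  have map_as: "map (load hs) as = b"
    unfolding as_def b_def sorted_vec_def by (rule properties_for_sort[symmetric]) simp_all
  have as: "distinct as" "set as = {1..n}" "length as = n" by (auto simp: as_def)
  define K where "K = set (take (Suc k) as)"
  have K: "K \<subseteq> {1..n}" "card K = Suc k"
    using as k set_take_subset[of "Suc k" as] by (auto simp: K_def distinct_card)
  have lK: "load hs j < Suc (b ! k)" if j: "j \<in> K" for j
  proof -
    obtain i where i: "i < Suc k" "j = as ! i" using j by (auto simp: K_def in_set_conv_nth)
    then have "load hs j = b ! i" using k as by (simp flip: map_as)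
    also have "\<dots> \<le> b ! k" unfolding b_def using i k by (intro sorted_vec_mono) auto
    finally show ?thesis by simp
  qed
  obtain z where z: "l = (\<lambda>i. \<Sum>t<length hs. z t i)" "\<forall>t<length hs. z t \<in> bases n (fst (hs ! t))"
    using l by (auto simp: hindsight_def)
  have "(\<Sum>j<Suc k. sorted_vec n l ! j) \<le> sum l K"
    using sum_smallest_le_sum[OF K(1), of l] K(2) by simp
  also have "\<dots> = (\<Sum>t<length hs. sum (z t) K)" unfolding z(1) by (rule sum.swap)
  also have "\<dots> \<le> (\<Sum>i=1..n. min (load hs i) (Suc (b ! k)))"
    using brick_laying_hindsight_le[OF hs z(2) K(1) lK order.refl] by simp
  also have "\<dots> \<le> (\<Sum>j<Suc k. b ! j) + (n - Suc k) * Suc (b ! k)"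
    unfolding b_def using k by (intro sum_min_le) simp
  \<comment> \<open>Strict because \<open>b ! k\<close> is raised to its successor; the result has
    the form assumed in \<open>sum_load_removed_le\<close>.\<close>
  also have "\<dots> < (\<Sum>j<k. b ! j) + Suc (b ! k) + (n - Suc k) * Suc (b ! k)" by simp
  also have "\<dots> = (\<Sum>j<k. b ! j) + (n - k) * Suc (b ! k)"
    using k by (metis Suc_diff_Suc mult_Suc add.assoc)
  finally show ?thesis .
qed

section \<open>The phase adversary\<close>

text \<open>For nonempty \<open>S\<close> inside \<open>{1..n}\<close> this is the rank-one uniform
  matroid on \<open>S\<close>. An empty \<open>S\<close> gives rank \<open>0\<close>, still a
  discrete polymatroid, so \<open>phase_adversary\<close> is legal on every history.\<close>

definition unit_polymatroid :: "nat \<Rightarrow> nat set \<Rightarrow> nvec set" where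
  "unit_polymatroid n S = polymatroid_of n (\<lambda>A. if A \<inter> S = {} then 0 else 1)"

definition unit_vec :: "nat \<Rightarrow> nvec" where
  "unit_vec j = (\<lambda>i. if i = j then 1 else 0)"

lemma rank_function_unit: "rank_function n (\<lambda>A. if A \<inter> S = {} then 0 else 1)"
  unfolding rank_function_def by auto

lemma discrete_polymatroid_unit: "discrete_polymatroid n (unit_polymatroid n S)"
  unfolding discrete_polymatroid_def unit_polymatroid_def using rank_function_unit by blast

lemma poly_rank_unit:
  assumes "S \<subseteq> {1..n}" "S \<noteq> {}"
  shows "poly_rank n (unit_polymatroid n S) = 1"
  unfolding unit_polymatroid_def
  using assms poly_rank_polymatroid_of[OF rank_function_unit, of n S] by (simp add: Int_absorb1)

lemma unit_vec_mem_bases: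
  assumes "S \<subseteq> {1..n}" "j \<in> S"
  shows "unit_vec j \<in> bases n (unit_polymatroid n S)"
proof -
  have *: "sum (unit_vec j) A = (if j \<in> A then 1 else 0)" if "A \<subseteq> {1..n}" for A
    using finite_subset[OF that] by (simp add: unit_vec_def)
  have "unit_vec j \<in> unit_polymatroid n S"
    using assms * by (auto simp: unit_polymatroid_def polymatroid_of_def vecs_def unit_vec_def)
  moreover have "poly_rank n (unit_polymatroid n S) = 1"
    using assms by (intro poly_rank_unit) auto
  moreover have "sum (unit_vec j) {1..n} = 1" using *[OF order.refl] assms by auto
  ultimately show ?thesis by (simp add: bases_def)
qed

lemma bases_unit_zero:
  assumes "x \<in> bases n (unit_polymatroid n S)" "i \<notin> S"
  shows "x i = 0"
proof (cases "i \<in> {1..n}")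
  case True
  have "\<forall>A\<subseteq>{1..n}. sum x A \<le> (if A \<inter> S = {} then 0 else 1)"
    using assms(1) by (simp add: bases_def unit_polymatroid_def polymatroid_of_def)
  from this[rule_format, of "{i}"] show ?thesis using True assms(2) by simp
next
  case False
  then show ?thesis
    using assms(1) by (simp add: bases_def unit_polymatroid_def polymatroid_of_def vecs_def)
qed

text \<open>
  Phase \<open>k\<close> consists of \<open>y k\<close> rounds presenting the rank-one uniform matroid on the active
  agents. At its end the active agent with the smallest load is removed; in hindsight this
  victim receives all bricks of the phase.
\<close>

definition phase_start :: "(nat \<Rightarrow> nat) \<Rightarrow> nat \<Rightarrow> nat" where
  "phase_start y k = (\<Sum>j<k. y j)"

text \<open>Rounds count from \<open>0\<close>, and phases of length \<open>0\<close> contain no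
  round. The value is controlled only for \<open>t < phase_start y n\<close>.\<close>

definition phase :: "(nat \<Rightarrow> nat) \<Rightarrow> nat \<Rightarrow> nat" where
  "phase y t = (LEAST k. t < phase_start y (Suc k))"

text \<open>Loads are read from the prefix that ends with the phase, so extending the history later
  does not change the set.\<close>

primrec removed :: "nat \<Rightarrow> (nat \<Rightarrow> nat) \<Rightarrow> history \<Rightarrow> nat \<Rightarrow> nat set" where
  "removed n y hs 0 = {}"
| "removed n y hs (Suc k) =
     insert (arg_min_on (load (take (phase_start y (Suc k)) hs)) ({1..n} - removed n y hs k))
       (removed n y hs k)"

definition victim :: "nat \<Rightarrow> (nat \<Rightarrow> nat) \<Rightarrow> history \<Rightarrow> nat \<Rightarrow> nat" where
  "victim n y hs k =
     arg_min_on (load (take (phase_start y (Suc k)) hs)) ({1..n} - removed n y hs k)"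

definition phase_adversary :: "nat \<Rightarrow> (nat \<Rightarrow> nat) \<Rightarrow> adversary" where
  "phase_adversary n y hs = unit_polymatroid n ({1..n} - removed n y hs (phase y (length hs)))"

lemma phase_start_mono: "j \<le> k \<Longrightarrow> phase_start y j \<le> phase_start y k"
  unfolding phase_start_def by (rule sum_mono2) auto

lemma phase_start_Suc: "phase_start y (Suc k) = phase_start y k + y k"
  by (simp add: phase_start_def)

lemma phase_bounds:
  assumes "t < phase_start y n"
  shows "phase y t < n" "phase_start y (phase y t) \<le> t" "t < phase_start y (Suc (phase y t))"
proof -
  have "n \<noteq> 0" using assms by (cases n) (simp_all add: phase_start_def)
  then obtain k where k: "n = Suc k" by (cases n) simp_all
  have *: "t < phase_start y (Suc k)" using assms k by simp
  then show "t < phase_start y (Suc (phase y t))" unfolding phase_def by (rule LeastI)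
  have "phase y t \<le> k" unfolding phase_def using * by (rule Least_le)
  then show "phase y t < n" using k by simp
  show "phase_start y (phase y t) \<le> t"
  proof (cases "phase y t")
    case (Suc j)
    then have "\<not> t < phase_start y (Suc j)" unfolding phase_def by (intro not_less_Least) simp
    then show ?thesis using Suc by simp
  qed (simp add: phase_start_def)
qed

lemma phase_eq_iff:
  assumes "t < phase_start y n"
  shows "phase y t = k \<longleftrightarrow> phase_start y k \<le> t \<and> t < phase_start y (Suc k)"
proof
  assume *: "phase_start y k \<le> t \<and> t < phase_start y (Suc k)"
  have "\<not> phase y t < k"
    using phase_start_mono[of "Suc (phase y t)" k y] phase_bounds(3)[OF assms] * by auto
  moreover have "\<not> k < phase y t"
    using phase_start_mono[of "Suc k" "phase y t" y] phase_bounds(2)[OF assms] * by auto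
  ultimately show "phase y t = k" by simp
qed (use phase_bounds[OF assms] in auto)

lemma removed_Suc: "removed n y hs (Suc k) = insert (victim n y hs k) (removed n y hs k)"
  by (simp add: victim_def)

lemma removed_mono: "j \<le> k \<Longrightarrow> removed n y hs j \<subseteq> removed n y hs k"
  by (rule lift_Suc_mono_le[of "removed n y hs"]) (auto simp: removed_Suc simp del: removed.simps)

lemma removed_subset_card:
  "k \<le> n \<Longrightarrow> removed n y hs k \<subseteq> {1..n} \<and> card (removed n y hs k) = k"
proof (induction k)
  case (Suc k)
  then have IH: "removed n y hs k \<subseteq> {1..n}" "card (removed n y hs k) = k" by auto
  then have fin: "finite (removed n y hs k)" using finite_subset by blast
  have "card ({1..n} - removed n y hs k) = n - k"
    using card_Diff_subset[OF fin IH(1)] IH(2) by simp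
  then have "{1..n} - removed n y hs k \<noteq> {}"
    using Suc.prems by (metis card.empty zero_less_diff less_irrefl Suc_le_lessD)
  then have "victim n y hs k \<in> {1..n} - removed n y hs k"
    unfolding victim_def by (intro arg_min_if_finite) auto
  then show ?case using IH fin by (simp add: removed_Suc del: removed.simps)
qed simp

lemma active_nonempty:
  assumes "k < n"
  shows "{1..n} - removed n y hs k \<noteq> {}" "card ({1..n} - removed n y hs k) = n - k"
proof -
  have r: "removed n y hs k \<subseteq> {1..n}" "card (removed n y hs k) = k"
    using removed_subset_card assms by auto
  show c: "card ({1..n} - removed n y hs k) = n - k"
    using r card_Diff_subset[of "removed n y hs k" "{1..n}"] finite_subset[OF r(1)] by simp
  show "{1..n} - removed n y hs k \<noteq> {}" using c assms by (metis card.empty zero_less_diff less_irrefl)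
qed

lemma victim_active: "k < n \<Longrightarrow> victim n y hs k \<in> {1..n} - removed n y hs k"
  unfolding victim_def by (intro arg_min_if_finite active_nonempty) auto

lemma load_victim_le:
  assumes "i \<in> {1..n} - removed n y hs k"
  shows "load (take (phase_start y (Suc k)) hs) (victim n y hs k) \<le>
    load (take (phase_start y (Suc k)) hs) i"
  unfolding victim_def using assms by (intro arg_min_least) blast+

lemma removed_eq_image: "removed n y hs k = victim n y hs ` {..<k}"
  by (induction k) (simp_all add: removed_Suc lessThan_Suc del: removed.simps(2))

text \<open>The \<open>n\<close> phases remove \<open>n\<close> distinct agents, hence all of
  them.\<close>

lemma bij_betw_victim: "bij_betw (victim n y hs) {..<n} {1..n}"
proof -
  have r: "removed n y hs n \<subseteq> {1..n}" "card (removed n y hs n) = n"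
    using removed_subset_card[of n n] by auto
  have "removed n y hs n = {1..n}" using r by (intro card_subset_eq) auto
  then show ?thesis
    using r(2) by (auto simp: bij_betw_def removed_eq_image intro!: eq_card_imp_inj_on)
qed

text \<open>Lets the adversary, who sees only a prefix, be analysed through the complete
  history.\<close>

lemma removed_take:
  "phase_start y k \<le> t \<Longrightarrow> removed n y (take t hs) k = removed n y hs k"
proof (induction k)
  case (Suc k)
  have "phase_start y k \<le> t" using Suc.prems phase_start_mono[of k "Suc k" y] by simp
  then have "removed n y (take t hs) k = removed n y hs k" by (rule Suc.IH)
  then show ?case using Suc.prems by (simp add: min_absorb1)
qed simp

text \<open>Each presented polymatroid has rank \<open>1\<close>, so the total rank counts the
  rounds and the game stops after exactly \<open>phase_start y n\<close> of them, whatever the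
  strategy.\<close>

lemma play_phase_adversary:
  assumes "hs \<in> set_pmf (play n (phase_start y n) A (phase_adversary n y) t)"
  shows "total_rank n hs = length hs \<and> length hs = min t (phase_start y n)"
  using assms
proof (induction t arbitrary: hs)
  case (Suc t)
  let ?adv = "phase_adversary n y" and ?m = "phase_start y n"
  from Suc.prems obtain hs' where hs': "hs' \<in> set_pmf (play n ?m A ?adv t)"
    and c: "hs \<in> set_pmf (if total_rank n hs' = ?m then return_pmf hs'
             else map_pmf (\<lambda>x. hs' @ [(?adv hs', x)]) (A hs' (?adv hs')))"
    by auto
  note IH = Suc.IH[OF hs']
  show ?case
  proof (cases "total_rank n hs' = ?m")
    case True
    then show ?thesis using c IH by simp
  next
    case False
    then have lt: "length hs' < ?m" using IH by simp
    obtain x where hs: "hs = hs' @ [(?adv hs', x)]" using c False by auto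
    have "poly_rank n (?adv hs') = 1"
      unfolding phase_adversary_def
      using phase_bounds(1)[OF lt] by (intro poly_rank_unit active_nonempty) auto
    then have "total_rank n hs = length hs" using hs IH by (simp add: total_rank_snoc)
    then show ?thesis using hs IH lt by simp
  qed
qed (simp add: total_rank_def)

lemma phase_adversary_mem_strategies:
  "phase_adversary n y \<in> adversarial_strategies n (phase_start y n)"
proof -
  have "game_over n (phase_start y n) A (phase_adversary n y) (phase_start y n)" for A
    using play_phase_adversary[of _ n y A "phase_start y n"] unfolding game_over_def by simp
  moreover have "discrete_polymatroid n (phase_adversary n y hs)" for hs
    unfolding phase_adversary_def by (rule discrete_polymatroid_unit)
  ultimately show ?thesis unfolding adversarial_strategies_def by blast
qed

text \<open>The counterpart of \<open>brick_laying_history\<close> for the phase adversary; the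
  active sets refer to the complete history, as \<open>removed_take\<close> permits.\<close>

definition phase_history :: "nat \<Rightarrow> (nat \<Rightarrow> nat) \<Rightarrow> history \<Rightarrow> bool" where
  "phase_history n y hs \<longleftrightarrow> valid_history n hs \<and> length hs = phase_start y n \<and>
     (\<forall>t<length hs. fst (hs ! t) = unit_polymatroid n ({1..n} - removed n y hs (phase y t)))"

lemma outcome_phase_adversary:
  assumes A: "A \<in> allocation_strategies n"
    and hs: "hs \<in> set_pmf (outcome n (phase_start y n) A (phase_adversary n y))"
  shows "phase_history n y hs"
  unfolding phase_history_def
proof (intro conjI allI impI)
  note adv = phase_adversary_mem_strategies[of n y]
  show "valid_history n hs" by (rule outcome_valid[OF A adv hs])
  show l: "length hs = phase_start y n"
    using outcome_total_rank[OF A adv hs] play_phase_adversary[OF hs[unfolded outcome_def]] by simp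
  fix t assume t: "t < length hs"
  have "fst (hs ! t) = phase_adversary n y (take t hs)"
    using set_pmf_play_round[OF hs[unfolded outcome_def] t] by simp
  then show "fst (hs ! t) = unit_polymatroid n ({1..n} - removed n y hs (phase y t))"
    using t l phase_bounds(2)[of t y n] by (simp add: phase_adversary_def removed_take)
qed

section \<open>Loads and hindsight loads in a phase history\<close>

context
  fixes n :: nat and y :: "nat \<Rightarrow> nat" and hs :: history
  assumes hs: "phase_history n y hs"
begin

lemma total_rank_phase_history:
  assumes "t \<le> length hs"
  shows "total_rank n (take t hs) = t"
proof -
  have "poly_rank n (fst (hs ! s)) = 1" if "s < t" for s
  proof -
    have s: "s < phase_start y n" using that assms hs by (simp add: phase_history_def)
    then have "fst (hs ! s) = unit_polymatroid n ({1..n} - removed n y hs (phase y s))"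
      using hs by (simp add: phase_history_def)
    then show ?thesis
      using poly_rank_unit[OF Diff_subset active_nonempty(1)[OF phase_bounds(1)[OF s]]] by simp
  qed
  then show ?thesis using assms by (simp add: total_rank_def)
qed

text \<open>Removed agents stay inactive, and inactive agents receive no bricks.\<close>

lemma load_frozen:
  assumes "a \<in> removed n y hs k" "phase_start y k \<le> t" "t \<le> length hs"
  shows "load (take t hs) a = load hs a"
proof -
  have "snd (hs ! s) a = 0" if s: "t \<le> s" "s < length hs" for s
  proof (rule bases_unit_zero[where x = "snd (hs ! s)" and i = a])
    show "snd (hs ! s) \<in> bases n (unit_polymatroid n ({1..n} - removed n y hs (phase y s)))"
      using hs s unfolding phase_history_def valid_history_def by metis
    have "s < phase_start y n" using hs s by (simp add: phase_history_def)
    note b = phase_bounds(3)[OF this]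
    have "\<not> phase y s < k"
      using phase_start_mono[of "Suc (phase y s)" k y] b assms(2) s by auto
    then show "a \<notin> {1..n} - removed n y hs (phase y s)"
      using removed_mono[of k "phase y s" n y hs] assms(1) by auto
  qed
  then have "(\<Sum>s=t..<length hs. snd (hs ! s) a) = 0" by simp
  then show ?thesis
    using sum_lessThan_split[OF assms(3), of "\<lambda>s. snd (hs ! s) a"] assms(3)
    by (simp add: load_take load_def)
qed

text \<open>Count the bricks at the end of phase \<open>k\<close>: removed agents already have their
  final load, each of the \<open>n - k\<close> active agents has at least the load of the victim,
  and the victim is frozen from then on.\<close>

lemma load_victim_bound:
  assumes k: "k < n"
  shows "sum (load hs) (removed n y hs k) + (n - k) * load hs (victim n y hs k) \<le> phase_start y (Suc k)"
proof -
  let ?t = "phase_start y (Suc k)" and ?R = "removed n y hs k"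
  have t: "?t \<le> length hs"
    using hs phase_start_mono[of "Suc k" n y] k by (simp add: phase_history_def)
  have R: "?R \<subseteq> {1..n}" using removed_subset_card k by simp
  have 1: "sum (load hs) ?R = sum (load (take ?t hs)) ?R"
    using t phase_start_mono[of k "Suc k" y] load_frozen[of _ k ?t] by (intro sum.cong) simp_all
  have 2: "load hs (victim n y hs k) = load (take ?t hs) (victim n y hs k)"
    using t load_frozen[of _ "Suc k" ?t] by (simp add: removed_Suc del: removed.simps)
  have 3: "(n - k) * load (take ?t hs) (victim n y hs k) \<le> sum (load (take ?t hs)) ({1..n} - ?R)"
    using sum_bounded_below[of "{1..n} - ?R" "load (take ?t hs) (victim n y hs k)" "load (take ?t hs)"]
      load_victim_le active_nonempty(2)[OF k] by simp
  have 4: "sum (load (take ?t hs)) ?R + sum (load (take ?t hs)) ({1..n} - ?R) = ?t"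
  proof -
    have "sum (load (take ?t hs)) {1..n} = ?t"
      using sum_load[of n hs ?t] hs t total_rank_phase_history[OF t] by (simp add: phase_history_def)
    then show ?thesis using sum.subset_diff[OF R, of "load (take ?t hs)"] by simp
  qed
  show ?thesis unfolding 1 2 using 3 4 by linarith
qed

text \<open>Induction on \<open>k\<close>. A victim may exceed \<open>b k\<close>, but then
  \<open>load_victim_bound\<close> and the hypothesis force the earlier victims to lie below their
  bound by enough to compensate.\<close>

lemma sum_load_removed_le:
  assumes b: "\<And>k. k < n \<Longrightarrow> phase_start y (Suc k) < (\<Sum>j<k. b j) + (n - k) * Suc (b k)"
  shows "k \<le> n \<Longrightarrow> sum (load hs) (removed n y hs k) \<le> (\<Sum>j<k. b j)"
proof (induction k)
  case (Suc k)
  let ?R = "sum (load hs) (removed n y hs k)" and ?v = "load hs (victim n y hs k)"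
    and ?B = "\<Sum>j<k. b j"
  have k: "k < n" using Suc.prems by simp
  have IH: "?R \<le> ?B" using Suc by simp
  have le: "?R + (n - k) * ?v < ?B + (n - k) * Suc (b k)"
    using load_victim_bound[OF k] b[OF k] by linarith
  have "?R + ?v \<le> ?B + b k"
  proof (cases "?v \<le> b k")
    case False
    \<comment> \<open>The excess \<open>d\<close> over \<open>Suc (b k)\<close> occurs
      \<open>n - k \<ge> 1\<close> times, so it is smaller than the slack
      \<open>?B - ?R\<close>.\<close>
    then obtain d where d: "?v = Suc (b k) + d" by (metis le_add_diff_inverse not_less_eq_eq)
    have "?R + (n - k) * d < ?B" using le unfolding d by (simp add: distrib_left)
    moreover have "d \<le> (n - k) * d" using k by (simp add: Suc_le_eq)
    ultimately show ?thesis using d by linarith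
  qed (use IH in linarith)
  moreover have "finite (removed n y hs k)"
    using removed_subset_card[of k n y hs] k finite_subset by auto
  ultimately show ?case
    using victim_active[OF k] by (simp add: removed_Suc del: removed.simps)
qed simp

text \<open>The victim of a phase is active throughout it, so it can take every brick of the phase.
  Victims enumerate all agents, which makes the resulting load a permutation of
  \<open>y\<close>.\<close>

lemma hindsight_phase_history:
  "\<exists>l\<in>hindsight n hs. sorted_vec n l = sort (map y [0..<n])"
proof -
  let ?v = "victim n y hs"
  define l where "l = (\<lambda>i. \<Sum>t<length hs. unit_vec (?v (phase y t)) i)"
  have len: "length hs = phase_start y n" using hs by (simp add: phase_history_def)
  have "unit_vec (?v (phase y t)) \<in> bases n (fst (hs ! t))" if "t < length hs" for t
  proof -
    have "fst (hs ! t) = unit_polymatroid n ({1..n} - removed n y hs (phase y t))"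
      using hs that by (simp add: phase_history_def)
    then show ?thesis
      using victim_active phase_bounds(1)[of t y n] that len by (simp add: unit_vec_mem_bases)
  qed
  then have l: "l \<in> hindsight n hs"
    unfolding hindsight_def l_def by (intro CollectI exI[of _ "\<lambda>t. unit_vec (?v (phase y t))"]) simp
  have lv: "l (?v k) = y k" if k: "k < n" for k
  proof -
    have "unit_vec (?v (phase y t)) (?v k) =
        (if t \<in> {phase_start y k..<phase_start y (Suc k)} then 1 else 0)" if t: "t < length hs" for t
    proof -
      have "?v k = ?v (phase y t) \<longleftrightarrow> k = phase y t"
        using k phase_bounds(1)[of t y n] t len
        by (intro inj_on_eq_iff[OF bij_betw_imp_inj_on[OF bij_betw_victim]]) simp_all
      then show ?thesis
        using phase_eq_iff[of t y n k] t len unfolding unit_vec_def by auto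
    qed
    then have "l (?v k) = (\<Sum>t<length hs. if t \<in> {phase_start y k..<phase_start y (Suc k)} then 1 else 0)"
      unfolding l_def by (intro sum.cong) auto
    also have "\<dots> = card ({..<length hs} \<inter> {phase_start y k..<phase_start y (Suc k)})"
      by (simp only: sum.inter_restrict[symmetric] finite_lessThan card_eq_sum)
    also have "{..<length hs} \<inter> {phase_start y k..<phase_start y (Suc k)} =
        {phase_start y k..<phase_start y (Suc k)}"
      using phase_start_mono[of "Suc k" n y] k len by auto
    finally show ?thesis by (simp add: phase_start_Suc)
  qed
  have "mset (map l [1..<Suc n]) = image_mset l (mset_set {1..n})"
    by (simp del: upt_Suc add: atLeastLessThanSuc_atLeastAtMost)
  also have "mset_set {1..n} = image_mset ?v (mset_set {..<n})"
    using image_mset_mset_set[of ?v "{..<n}"] bij_betw_victim[of n y hs] by (simp add: bij_betw_def)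
  also have "image_mset l (image_mset ?v (mset_set {..<n})) = image_mset y (mset_set {..<n})"
    using lv by (auto simp: image_mset.compositionality intro!: image_mset_cong)
  also have "\<dots> = mset (map y [0..<n])" by (simp add: lessThan_atLeast0)
  finally have "sorted_vec n l = sort (map y [0..<n])"
    unfolding sorted_vec_def by (intro properties_for_sort) simp_all
  then show ?thesis using l by blast
qed

end

section \<open>Optimality of brick-laying\<close>

text \<open>For sorted phase lengths, \<open>phase_start\<close> at \<open>Suc k\<close> is the sum
  of the \<open>k + 1\<close> smallest entries of \<open>l\<close>, so
  \<open>brick_laying_hindsight_sorted_le\<close> is the hypothesis of
  \<open>sum_load_removed_le\<close>. The \<open>k\<close> removed agents then bound the
  \<open>k\<close> smallest loads.\<close>

lemma majorized_phase_history:
  assumes hs0: "brick_laying_history n hs0" and l: "l \<in> hindsight n hs0"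
    and hs: "phase_history n ((!) (sorted_vec n l)) hs"
  shows "majorized n (load hs0) (load hs)"
  unfolding majorized_iff_sum_smallest
proof (intro conjI allI impI)
  let ?y = "(!) (sorted_vec n l)"
  have valid: "valid_history n hs0"
    using hs0 by (simp add: brick_laying_history_def valid_history_def brick_laying_choices_def)
  have "sum (load hs) {1..n} = phase_start ?y n"
    using sum_load[of n hs "length hs"] total_rank_phase_history[OF hs, of "length hs"] hs
    by (simp add: phase_history_def)
  also have "\<dots> = sum l {1..n}" using sum_sorted_vec[of "\<lambda>a. a" l n] by (simp add: phase_start_def)
  also have "\<dots> = sum (load hs0) {1..n}"
    using hindsight_vecs(2)[OF valid l] sum_load[OF valid, of "length hs0"] by simp
  finally show "sum (load hs) {1..n} = sum (load hs0) {1..n}" .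
  fix k assume k: "k \<le> n"
  have R: "removed n ?y hs k \<subseteq> {1..n}" "card (removed n ?y hs k) = k"
    using removed_subset_card[OF k] by auto
  have "(\<Sum>j<k. sorted_vec n (load hs) ! j) \<le> sum (load hs) (removed n ?y hs k)"
    using sum_smallest_le_sum[OF R(1), of "load hs"] R(2) by simp
  also have "\<dots> \<le> (\<Sum>j<k. sorted_vec n (load hs0) ! j)"
    using brick_laying_hindsight_sorted_le[OF hs0 l] k
    by (intro sum_load_removed_le[OF hs]) (simp_all add: phase_start_def)
  finally show "(\<Sum>j<k. sorted_vec n (load hs) ! j) \<le> (\<Sum>j<k. sorted_vec n (load hs0) ! j)" .
qed

text \<open>The witness depends only on \<open>l\<close>; it adapts to \<open>A\<close> through the
  observed loads, and domination holds on every history in the support.\<close>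

lemma exists_dominating_adversary:
  assumes hs0: "brick_laying_history n hs0" "total_rank n hs0 = m" and l: "l \<in> hindsight n hs0"
    and A: "A \<in> allocation_strategies n"
  shows "\<exists>adv\<in>adversarial_strategies n m. \<forall>hs\<in>set_pmf (outcome n m A adv).
     majorized n (load hs0) (load hs) \<and> (\<exists>l'\<in>hindsight n hs. majorized n l' l)"
proof -
  let ?y = "(!) (sorted_vec n l)"
  have valid: "valid_history n hs0"
    using hs0(1) by (simp add: brick_laying_history_def valid_history_def brick_laying_choices_def)
  have m: "phase_start ?y n = m"
    using sum_sorted_vec[of "\<lambda>a. a" l n] hindsight_vecs(2)[OF valid l] hs0(2)
    by (simp add: phase_start_def)
  have sort_y: "sort (map ?y [0..<n]) = sorted_vec n l"
  proof -
    have "map ?y [0..<n] = sorted_vec n l" using map_nth[of "sorted_vec n l"] by simp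
    then show ?thesis by (simp add: sorted_vec_def sorted_sort_id del: upt_Suc)
  qed
  show ?thesis
  proof (rule bexI, intro ballI conjI)
    show "phase_adversary n ?y \<in> adversarial_strategies n m"
      using phase_adversary_mem_strategies[of n ?y] m by simp
    fix hs assume "hs \<in> set_pmf (outcome n m A (phase_adversary n ?y))"
    then have hs: "phase_history n ?y hs" using outcome_phase_adversary[OF A, of hs ?y] m by simp
    show "majorized n (load hs0) (load hs)" by (rule majorized_phase_history[OF hs0(1) l hs])
    obtain l' where "l' \<in> hindsight n hs" "sorted_vec n l' = sorted_vec n l"
      using hindsight_phase_history[OF hs] sort_y by auto
    then show "\<exists>l'\<in>hindsight n hs. majorized n l' l" using majorized_of_sorted_vec_eq by blast
  qed
qed

text \<open>Each adversary against brick-laying is matched by one that costs \<open>A\<close> at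
  least as much: its hindsight optimum is no smaller and the load of \<open>A\<close> is no more
  balanced.\<close>

lemma regret_max_brick_laying_le:
  assumes "\<alpha> > 0" and tie: "tie_breaking tie" and f: "schur_concave n f"
    and A: "A \<in> allocation_strategies n"
  shows "regret_max n m f \<alpha> (brick_laying n tie) \<le> regret_max n m f \<alpha> A"
  unfolding regret_max_def
proof (rule SUP_mono)
  fix adv assume adv: "adv \<in> adversarial_strategies n m"
  let ?BL = "brick_laying n tie"
  have BL: "?BL \<in> allocation_strategies n" by (rule brick_laying_mem_strategies[OF tie])
  obtain hs0 where hs0: "outcome n m ?BL adv = return_pmf hs0"
    using play_brick_laying_deterministic unfolding outcome_def by blast
  then have mem: "hs0 \<in> set_pmf (outcome n m ?BL adv)" by simp
  note valid0 = outcome_valid[OF BL adv mem]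
  \<comment> \<open>The hindsight set is finite and nonempty, so the supremum is attained at some
    \<open>l\<close>, which the new adversary reproduces up to permutation.\<close>
  have "Max (f ` hindsight n hs0) \<in> f ` hindsight n hs0"
    using finite_hindsight[OF valid0] hindsight_nonempty[OF valid0] by (intro Max_in) auto
  then obtain l where l: "l \<in> hindsight n hs0" "f l = Max (f ` hindsight n hs0)" by auto
  have "(SUP l\<in>hindsight n hs0. f l) = f l"
    unfolding l(2) using finite_hindsight[OF valid0] hindsight_nonempty[OF valid0]
    by (intro cSup_eq_Max) auto
  then have cost0: "cost_max n m f \<alpha> ?BL adv = \<alpha> * f l - f (load hs0)"
    by (simp add: cost_max_def hs0)
  obtain adv' where adv': "adv' \<in> adversarial_strategies n m"
    and dom: "\<And>hs. hs \<in> set_pmf (outcome n m A adv') \<Longrightarrow>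
      majorized n (load hs0) (load hs) \<and> (\<exists>l'\<in>hindsight n hs. majorized n l' l)"
    using exists_dominating_adversary[OF outcome_brick_laying[OF tie adv mem]
        outcome_total_rank[OF BL adv mem] l(1) A] by blast
  have "\<alpha> * f l - f (load hs0) \<le> cost_max n m f \<alpha> A adv'"
    unfolding cost_max_def
  proof (rule expectation_outcome_ge[OF A adv'])
    fix hs assume hs: "hs \<in> set_pmf (outcome n m A adv')"
    note valid = outcome_valid[OF A adv' hs]
    obtain l' where l': "l' \<in> hindsight n hs" "majorized n l' l" using dom[OF hs] by blast
    have "f l \<le> f l'"
      using f l'(2) hindsight_vecs(1)[OF valid0 l(1)] hindsight_vecs(1)[OF valid l'(1)]
      by (simp add: schur_concave_def)
    also have "\<dots> \<le> (SUP l\<in>hindsight n hs. f l)"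
      using l'(1) finite_hindsight[OF valid] by (intro cSUP_upper) auto
    finally have "\<alpha> * f l \<le> \<alpha> * (SUP l\<in>hindsight n hs. f l)"
      using \<open>\<alpha> > 0\<close> by (intro mult_left_mono) auto
    moreover have "f (load hs) \<le> f (load hs0)"
      using f dom[OF hs] load_vecs[OF valid] load_vecs[OF valid0] by (simp add: schur_concave_def)
    ultimately show "\<alpha> * f l - f (load hs0) \<le> \<alpha> * (SUP l\<in>hindsight n hs. f l) - f (load hs)"
      by simp
  qed
  then show "\<exists>adv'\<in>adversarial_strategies n m.
      ereal (cost_max n m f \<alpha> ?BL adv) \<le> ereal (cost_max n m f \<alpha> A adv')"
    using adv' cost0 by auto
qed

text \<open>On the reals \<open>Inf\<close> is by definition the negated \<open>Sup\<close> of the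
  negated set, so negating the objective exchanges the two costs exactly.\<close>

lemma regret_min_eq_regret_max: "regret_min n m g \<alpha> A = regret_max n m (\<lambda>x. - g x) \<alpha> A"
  unfolding regret_min_def regret_max_def cost_min_def cost_max_def
  by (simp add: Inf_real_def image_image add.commute)

theorem corollary1:
  fixes n m :: nat and \<alpha> :: real and tie :: tie_rule
  assumes "\<alpha> > 0"
    and "tie_breaking tie"
  shows "(\<forall>f. (\<forall>x\<in>vecs n. f x \<ge> 0) \<and> schur_concave n f \<longrightarrow>
            (\<forall>A'\<in>allocation_strategies n.
               regret_max n m f \<alpha> (brick_laying n tie) \<le> regret_max n m f \<alpha> A')) \<and>
         (\<forall>g. (\<forall>x\<in>vecs n. g x \<ge> 0) \<and> schur_convex n g \<longrightarrow>
            (\<forall>A'\<in>allocation_strategies n.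
               regret_min n m g \<alpha> (brick_laying n tie) \<le> regret_min n m g \<alpha> A'))"
proof (intro conjI allI impI ballI; elim conjE)
  fix g A' assume "schur_convex n g" and A': "A' \<in> allocation_strategies n"
  then have "schur_concave n (\<lambda>x. - g x)" by (simp add: schur_concave_def schur_convex_def)
  from regret_max_brick_laying_le[OF assms this A', of m]
  show "regret_min n m g \<alpha> (brick_laying n tie) \<le> regret_min n m g \<alpha> A'"
    by (simp add: regret_min_eq_regret_max)
qed (rule regret_max_brick_laying_le[OF assms])

end
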